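(* If $X$ is a complete metric space with $\dim_A X<\infty$, then for all $0<s<\dim_L X$, there is a measure $\mu$ with support $X$ such that $\dim_L\mu=s$.
   Context: For a metric space $X=(X,d)$, $B(x,R)=\{y\in X: d(x,y)\le R\}$ denotes the closed ball, $N(x,R,r)$ denotes the minimal number of closed balls of radius $r$ needed to cover $B(x,R)$, and $\operatorname{diam}(X)$ is the diameter of $X$. The Assouad dimension $\dim_A X$ is the infimum of those $\alpha\ge 0$ for which there is a constant $0<C<\infty$ such that $N(x,R,r)\le C(R/r)^\alpha$ for all $x\in X$ and $0<r<R<\infty$ (and $\dim_A X=\infty$ if there is no such $\alpha\in[0,\infty)$). The lower dimension $\dim_L X$ is the supremum of the exponents $\alpha$ for which there is a constant $0<C<\infty$ such that $$N(x,R,r)\ge C\left(\frac{R}{r}\right)^\alpha\quad\text{for all }x\in X\text{ and }0<r<R<\operatorname{diam}(X).$$ A measure on $X$ means a Borel regular outer measure on $X$, and measures are always assumed to be fully supported, that is, $\operatorname{spt}\mu=X$. The lower dimension $\dim_L\mu$ of a measure $\mu$ is, analogously, the supremum of those $\alpha$ for which there is a constant $0<C<\infty$ such that $$\frac{\mu(B(x,R))}{\mu(B(x,r))}\ge C\left(\frac{R}{r}\right)^\alpha\quad\text{for all }x\in X\text{ and }0<r<R<\operatorname{diam}(X).$$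
   Formalization: The space X is assumed to have at least two points; for a one-point space diam(X)=0, so both lower dimensions are vacuously infinite and no measure can have lower dimension s. *)

theory Defs
  imports "HOL-Analysis.Analysis"
begin

text \<open>The metric space \<open>X\<close> is the universe of a type \<open>'a\<close>; quantities attached to \<open>X\<close> alone take
  \<open>TYPE('a)\<close> as argument.\<close>

text \<open>The library's \<^const>\<open>diameter\<close> is real-valued and unspecified on unbounded sets.\<close>

definition ediam :: "'a::metric_space itself \<Rightarrow> ereal" where
  "ediam _ = (SUP x::'a. SUP y::'a. ereal (dist x y))"

text \<open>The value is \<open>\<infinity>\<close> if no finite cover exists.\<close>

definition cover_num :: "'a::metric_space \<Rightarrow> real \<Rightarrow> real \<Rightarrow> enat" where
  "cover_num x R r =
     (INF F\<in>{F. finite F \<and> cball x R \<subseteq> (\<Union>y\<in>F. cball y r)}. enat (card F))"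

definition assouad_dim :: "'a::metric_space itself \<Rightarrow> ereal" where
  "assouad_dim _ = Inf {ereal \<alpha> | \<alpha>. 0 \<le> \<alpha> \<and>
     (\<exists>C>0. \<forall>(x::'a) r R. 0 < r \<and> r < R \<longrightarrow>
        ereal_of_enat (cover_num x R r) \<le> ereal (C * (R / r) powr \<alpha>))}"

text \<open>For a one-point space the condition on \<open>\<alpha>\<close> is vacuous, and both lower dimensions below
  are \<open>\<infinity>\<close>.\<close>

definition lower_dim :: "'a::metric_space itself \<Rightarrow> ereal" where
  "lower_dim _ = Sup {ereal \<alpha> | \<alpha>.
     \<exists>C>0. \<forall>(x::'a) r R. 0 < r \<and> r < R \<and> ereal R < ediam TYPE('a) \<longrightarrow>
        ereal_of_enat (cover_num x R r) \<ge> ereal (C * (R / r) powr \<alpha>)}"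

text \<open>Members of \<^const>\<open>lambda_system\<close> are the Caratheodory measurable sets. The library
  states countable subadditivity for disjoint families only; on \<open>Pow UNIV\<close>, with monotonicity, this
  gives it for all countable families.\<close>

definition borel_regular_outer_measure :: "('a::topological_space set \<Rightarrow> ennreal) \<Rightarrow> bool" where
  "borel_regular_outer_measure \<mu> \<longleftrightarrow>
     outer_measure_space (Pow UNIV) \<mu> \<and>
     sets borel \<subseteq> lambda_system UNIV (Pow UNIV) \<mu> \<and>
     (\<forall>A. \<exists>B\<in>sets borel. A \<subseteq> B \<and> \<mu> B = \<mu> A)"

definition spt :: "('a::topological_space set \<Rightarrow> ennreal) \<Rightarrow> 'a set" where
  "spt \<mu> = {x. \<forall>U. open U \<and> x \<in> U \<longrightarrow> 0 < \<mu> U}"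

text \<open>Since \<open>a / \<infinity> = 0\<close> in \<^typ>\<open>ennreal\<close>, an exponent can only be admissible if all balls of
  radius less than the diameter have finite measure; hence a measure of positive lower dimension
  is finite on these balls.\<close>

definition lower_dim_measure :: "('a::metric_space set \<Rightarrow> ennreal) \<Rightarrow> ereal" where
  "lower_dim_measure \<mu> = Sup {ereal \<alpha> | \<alpha>.
     \<exists>C>0. \<forall>(x::'a) r R. 0 < r \<and> r < R \<and> ereal R < ediam TYPE('a) \<longrightarrow>
        \<mu> (cball x R) / \<mu> (cball x r) \<ge> ennreal (C * (R / r) powr \<alpha>)}"

end

theory Submission
  imports Defs "HOL-Probability.Probability"
begin

text \<open>Fix a small \<open>l\<close> and, for every integer \<open>k\<close>, a maximal separated set \<open>net k\<close> of scale
  \<open>a k = \<rho> * l powi k\<close> containing a fixed point \<open>root\<close>. Attaching every point of \<open>net (k + 1)\<close> to a nearby point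
  of \<open>net k\<close> gives a tree. Finiteness of the Assouad dimension bounds the number of children from above, and
  \<open>s < dim_L X\<close> gives each node more than \<open>2 / \<theta>\<close> children, where \<open>\<theta> = l powr s\<close>. Hence the unit mass of a node
  can be distributed so that every child gets at most \<open>\<theta>\<close>, while \<open>root\<close> passes exactly \<open>\<theta>\<close> to itself.
  The first property alone gives \<open>\<mu> (B(x,r)) \<le> C (r/R)^s \<mu> (B(x,R))\<close>: the ball \<open>B(x,r)\<close> meets boundedly many
  nodes of scale \<open>r\<close>, and each has at most the fraction \<open>C (r/R)^s\<close> of the mass of an ancestor of
  scale \<open>R\<close> lying inside \<open>B(x,R)\<close>. The second property gives \<open>\<mu> (B(root,r)) \<ge> c r^s\<close>, so no exponent
  above \<open>s\<close> is admissible. The mass distribution is realised as the law of the limit of a random descent through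
  the tree; if \<open>X\<close> is unbounded, \<open>\<mu>\<close> is the increasing limit of the suitably normalised laws started
  at \<open>root\<close> on level \<open>- n\<close>.\<close>

section \<open>Outer measures induced by Borel measures\<close>

text \<open>Every set has a measurable hull with the same outer measure. Subadditivity and
  Caratheodory splitting are transferred from such hulls to arbitrary sets, and the hull itself
  gives Borel regularity.\<close>

lemma borel_regular_outer_measure_of:
  assumes "sets M = sets borel"
  shows "borel_regular_outer_measure (outer_measure_of M)"
proof -
  have space: "space M = UNIV"
    using sets_eq_imp_space_eq[OF assms] by simp
  have attain: "\<exists>E\<in>sets M. A \<subseteq> E \<and> outer_measure_of M A = emeasure M E" for A
    using outer_measure_of_attain[of A M] space by simp
  have sub: "outer_measure_of M (\<Union>i. A i) \<le> (\<Sum>i. outer_measure_of M (A i))" for A :: "nat \<Rightarrow> _"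
  proof -
    have "\<forall>i. \<exists>E. E \<in> sets M \<and> A i \<subseteq> E \<and> outer_measure_of M (A i) = emeasure M E"
      using attain by blast
    then obtain E where E: "\<And>i. E i \<in> sets M" "\<And>i. A i \<subseteq> E i"
      "\<And>i. outer_measure_of M (A i) = emeasure M (E i)"
      by metis
    have "outer_measure_of M (\<Union>i. A i) \<le> outer_measure_of M (\<Union>i. E i)"
      using E(2) by (intro outer_measure_of_mono) blast
    also have "\<dots> = emeasure M (\<Union>i. E i)"
      using E(1) by simp
    also have "\<dots> \<le> (\<Sum>i. emeasure M (E i))"
      using E(1) by (intro emeasure_subadditive_countably) auto
    finally show ?thesis
      using E(3) by simp
  qed
  have split: "outer_measure_of M (B \<inter> A) + outer_measure_of M (- B \<inter> A) = outer_measure_of M A"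
    if B: "B \<in> sets borel" for A B
  proof (rule antisym)
    obtain E where E: "E \<in> sets M" "A \<subseteq> E" "outer_measure_of M A = emeasure M E"
      using attain by blast
    have BM: "B \<inter> E \<in> sets M" "- B \<inter> E \<in> sets M"
      using B E(1) assms by (auto intro: borel_comp)
    have "outer_measure_of M (B \<inter> A) + outer_measure_of M (- B \<inter> A)
        \<le> outer_measure_of M (B \<inter> E) + outer_measure_of M (- B \<inter> E)"
      using E(2) by (intro add_mono outer_measure_of_mono) auto
    also have "\<dots> = emeasure M (B \<inter> E) + emeasure M (- B \<inter> E)"
      using BM by simp
    also have "\<dots> = emeasure M ((B \<inter> E) \<union> (- B \<inter> E))"
      using BM by (intro plus_emeasure) auto
    also have "(B \<inter> E) \<union> (- B \<inter> E) = E"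
      by auto
    finally show "outer_measure_of M (B \<inter> A) + outer_measure_of M (- B \<inter> A) \<le> outer_measure_of M A"
      using E(3) by simp
    obtain E1 E2 where E12: "E1 \<in> sets M" "B \<inter> A \<subseteq> E1" "outer_measure_of M (B \<inter> A) = emeasure M E1"
      "E2 \<in> sets M" "- B \<inter> A \<subseteq> E2" "outer_measure_of M (- B \<inter> A) = emeasure M E2"
      using attain by metis
    have "outer_measure_of M A \<le> outer_measure_of M (E1 \<union> E2)"
      using E12 by (intro outer_measure_of_mono) auto
    also have "\<dots> = emeasure M (E1 \<union> E2)"
      using E12 by simp
    also have "\<dots> \<le> emeasure M E1 + emeasure M E2"
      using E12 by (intro emeasure_subadditive) auto
    finally show "outer_measure_of M A \<le> outer_measure_of M (B \<inter> A) + outer_measure_of M (- B \<inter> A)"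
      using E12 by simp
  qed
  have "outer_measure_space (Pow UNIV) (outer_measure_of M)"
    unfolding outer_measure_space_def positive_def increasing_def countably_subadditive_def
    using sub by (auto intro: outer_measure_of_mono)
  moreover have "sets borel \<subseteq> lambda_system UNIV (Pow UNIV) (outer_measure_of M)"
    using split by (auto simp: lambda_system_def Compl_eq_Diff_UNIV)
  moreover have "\<exists>B\<in>sets borel. A \<subseteq> B \<and> outer_measure_of M B = outer_measure_of M A" for A
    using attain[of A] assms by (metis outer_measure_of_eq)
  ultimately show ?thesis
    unfolding borel_regular_outer_measure_def by blast
qed

section \<open>Random descents\<close>

text \<open>A descent starts at a point \<open>y\<close> of level \<open>k\<close>; the random index \<open>i\<close>, drawn from \<open>Q\<close>, moves it to the
  point \<open>sel k y i\<close> of level \<open>k + 1\<close>. Completeness gives the descent an endpoint.\<close>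

locale random_descent =
  fixes Q :: "nat pmf" and sel :: "int \<Rightarrow> 'a::complete_space \<Rightarrow> nat \<Rightarrow> 'a"
    and a :: "int \<Rightarrow> real" and l :: real
  assumes l_pos: "0 < l" and l_le: "l \<le> 1/8"
    and a_pos: "\<And>k. 0 < a k" and a_Suc: "\<And>k. a (k + 1) = l * a k"
    and sel_dist: "\<And>k y i. dist (sel k y i) y \<le> a k"
begin

lemma a_add: "a (k + int n) = l ^ n * a k"
proof (induction n)
  case (Suc n)
  have "a (k + int (Suc n)) = l * a (k + int n)"
    using a_Suc[of "k + int n"] by (simp add: ac_simps)
  then show ?case
    using Suc by simp
qed simp

lemma a_Suc_le: "a (k + 1) \<le> a k / 8"
  using a_Suc[of k] l_le a_pos[of k] mult_right_mono[of l "1/8" "a k"] by simp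

lemma a_mono: "j \<le> k \<Longrightarrow> a k \<le> a j"
  using a_add[of j "nat (k - j)"] l_pos l_le a_pos[of j]
  by (simp add: mult_left_le_one_le power_le_one)

lemma a_tendsto: "(\<lambda>n. a (k + int n)) \<longlonglongrightarrow> 0"
proof -
  have "(\<lambda>n. l ^ n * a k) \<longlonglongrightarrow> 0 * a k"
    using l_pos l_le by (intro tendsto_intros LIMSEQ_realpow_zero) auto
  then show ?thesis
    by (simp add: a_add)
qed

section \<open>Walks and their endpoints\<close>

primrec walk :: "nat \<Rightarrow> int \<Rightarrow> 'a \<Rightarrow> nat stream \<Rightarrow> 'a" where
  "walk 0 k y w = y"
| "walk (Suc n) k y w = walk n (k + 1) (sel k y (shd w)) (stl w)"

lemma walk_add: "walk (m + n) k y w = walk m (k + int n) (walk n k y w) (sdrop n w)"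
  by (induction n arbitrary: k y w) (simp_all add: ac_simps)

text \<open>The steps shrink by the factor \<open>l\<close>, so a geometric series bounds the
  displacement. The constant 2 reproduces itself because \<open>a k + 2 * a (k + 1)\<close> is at
  most \<open>2 * a k\<close>.\<close>

lemma dist_walk_start: "dist (walk n k y w) y \<le> 2 * a k"
proof (induction n arbitrary: k y w)
  case 0
  show ?case using a_pos[of k] by simp
next
  case (Suc n)
  have "dist (walk (Suc n) k y w) y \<le> dist (walk n (k + 1) (sel k y (shd w)) (stl w)) (sel k y (shd w))
      + dist (sel k y (shd w)) y"
    by (simp add: dist_triangle)
  also have "\<dots> \<le> 2 * a (k + 1) + a k"
    by (intro add_mono Suc sel_dist)
  also have "\<dots> \<le> 2 * a k"
    using a_Suc_le[of k] a_pos[of k] by simp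
  finally show ?case .
qed

lemma dist_walk: "n \<le> m \<Longrightarrow> dist (walk m k y w) (walk n k y w) \<le> 2 * a (k + int n)"
  using walk_add[of "m - n" n k y w] dist_walk_start by simp

lemma Cauchy_walk: "Cauchy (\<lambda>n. walk n k y w)"
proof (rule metric_CauchyI)
  fix e :: real assume "0 < e"
  with a_tendsto[of k] have "eventually (\<lambda>n. a (k + int n) < e / 4) sequentially"
    by (intro order_tendstoD) auto
  then obtain n where n: "a (k + int n) < e / 4"
    by (auto simp: eventually_sequentially)
  have "dist (walk m k y w) (walk m' k y w) < e" if "n \<le> m" "n \<le> m'" for m m'
    using dist_triangle2[of "walk m k y w" "walk m' k y w" "walk n k y w"]
      dist_walk[OF that(1), of k y w] dist_walk[OF that(2), of k y w] n by linarith
  then show "\<exists>N. \<forall>m\<ge>N. \<forall>n\<ge>N. dist (walk m k y w) (walk n k y w) < e"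
    by blast
qed

definition endpoint :: "int \<Rightarrow> 'a \<Rightarrow> nat stream \<Rightarrow> 'a" where
  "endpoint k y w = lim (\<lambda>n. walk n k y w)"

lemma walk_tendsto: "(\<lambda>n. walk n k y w) \<longlonglongrightarrow> endpoint k y w"
  unfolding endpoint_def using Cauchy_walk[of k y w]
  by (simp add: Cauchy_convergent_iff convergent_LIMSEQ_iff)

lemma endpoint_Stream: "endpoint k y (i ## w) = endpoint (k + 1) (sel k y i) w"
proof -
  have "(\<lambda>n. walk (Suc n) k y (i ## w)) \<longlonglongrightarrow> endpoint k y (i ## w)"
    by (rule LIMSEQ_Suc[OF walk_tendsto])
  then have "(\<lambda>n. walk n (k + 1) (sel k y i) w) \<longlonglongrightarrow> endpoint k y (i ## w)"
    by simp
  from LIMSEQ_unique[OF this walk_tendsto] show ?thesis .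
qed

lemma dist_endpoint: "dist (endpoint k y w) y \<le> 2 * a k"
proof (rule Lim_bounded)
  show "(\<lambda>n. dist (walk n k y w) y) \<longlonglongrightarrow> dist (endpoint k y w) y"
    by (intro tendsto_intros walk_tendsto)
qed (use dist_walk_start in auto)

section \<open>Laws of the endpoints\<close>

abbreviation \<Omega> :: "nat stream measure" where "\<Omega> \<equiv> stream_space (measure_pmf Q)"

lemma walk_measurable [measurable]: "walk n k y \<in> measurable \<Omega> borel"
proof (induction n arbitrary: k y)
  case (Suc n)
  have shd: "shd \<in> measurable \<Omega> (count_space UNIV)"
    using measurable_shd[of "measure_pmf Q"] by simp
  have "(\<lambda>w. walk n (k + 1) (sel k y i) (stl w)) \<in> measurable \<Omega> borel" for i
    by (rule measurable_compose[OF measurable_stl Suc])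
  \<comment> \<open>The first index takes countably many values, so measurability may be checked for
    each fixed value \<open>i\<close>.\<close>
  from measurable_compose_countable[OF this shd] show ?case
    by (simp add: walk.simps(2)[abs_def])
qed (simp add: walk.simps(1)[abs_def])

lemma endpoint_measurable [measurable]: "endpoint k y \<in> measurable \<Omega> borel"
  by (rule borel_measurable_LIMSEQ_metric[where f = "\<lambda>n. walk n k y"]) (auto intro: walk_tendsto)

definition law :: "int \<Rightarrow> 'a \<Rightarrow> 'a measure" where
  "law k y = distr \<Omega> borel (endpoint k y)"

lemma sets_law [simp]: "sets (law k y) = sets borel"
  by (simp add: law_def)

lemma prob_space_law: "prob_space (law k y)"
  unfolding law_def by (intro prob_space.prob_space_distr prob_space.prob_space_stream_space[OF prob_space_measure_pmf]) simp

text \<open>The tail of an i.i.d. stream is i.i.d. and independent of the head, so conditioning on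
  the first index restarts the descent one level finer. The later estimates of laws combine this
  recursion with the support bound \<open>dist_endpoint\<close>.\<close>

lemma law_step:
  assumes [measurable]: "B \<in> sets borel"
  shows "emeasure (law k y) B = (\<integral>\<^sup>+i. emeasure (law (k + 1) (sel k y i)) B \<partial>measure_pmf Q)"
proof -
  have eq: "emeasure (law k y) B = (\<integral>\<^sup>+w. indicator B (endpoint k y w) \<partial>\<Omega>)" for k y
  proof -
    have "emeasure (law k y) B = (\<integral>\<^sup>+x. indicator B x \<partial>distr \<Omega> borel (endpoint k y))"
      by (simp add: law_def)
    also have "\<dots> = (\<integral>\<^sup>+w. indicator B (endpoint k y w) \<partial>\<Omega>)"
      by (rule nn_integral_distr) simp_all
    finally show ?thesis .
  qed
  show ?thesis
    unfolding eq by (subst prob_space.nn_integral_stream_space[OF prob_space_measure_pmf])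
      (simp_all add: endpoint_Stream)
qed

lemma law_le_1: "emeasure (law k y) B \<le> 1"
  using prob_space.emeasure_le_1[OF prob_space_law] .

lemma law_eq_1:
  assumes "cball y (2 * a k) \<subseteq> B" "B \<in> sets borel"
  shows "emeasure (law k y) B = 1"
proof -
  have "emeasure (law k y) B = emeasure \<Omega> (endpoint k y -` B \<inter> space \<Omega>)"
    using assms(2) by (simp add: law_def emeasure_distr)
  also have "endpoint k y -` B \<inter> space \<Omega> = space \<Omega>"
  proof -
    have "endpoint k y w \<in> B" for w
      using assms(1) dist_endpoint[of k y w] by (auto simp: dist_commute)
    then show ?thesis by auto
  qed
  also have "emeasure \<Omega> (space \<Omega>) = 1"
    by (intro prob_space.emeasure_space_1 prob_space.prob_space_stream_space[OF prob_space_measure_pmf])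
  finally show ?thesis .
qed

lemma law_eq_0:
  assumes "cball y (2 * a k) \<inter> B = {}" "B \<in> sets borel"
  shows "emeasure (law k y) B = 0"
proof -
  have "endpoint k y -` B \<inter> space \<Omega> = {}"
  proof -
    have "endpoint k y w \<notin> B" for w
      using assms(1) dist_endpoint[of k y w] by (auto simp: dist_commute)
    then show ?thesis by auto
  qed
  then show ?thesis
    using assms(2) by (simp add: law_def emeasure_distr)
qed

end

section \<open>Mass distribution on a tree of nets\<close>

text \<open>The points of \<open>net k\<close> play the role of dyadic cubes of size \<open>a k\<close>, small sizes belonging to
  large \<open>k\<close>, and \<open>par k\<close> maps a point of level \<open>k + 1\<close> to the cube of level \<open>k\<close> containing it.
  The tree is used from the levels \<open>top n\<close> on: \<open>top n = 0\<close> if the space is bounded and \<open>top n = - n\<close>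
  otherwise. The last assumption says that every point eventually has \<open>root\<close> as an ancestor, which
  makes the limit measure fully supported.\<close>

locale net_tree = random_descent Q sel a l
  for Q :: "nat pmf" and sel :: "int \<Rightarrow> 'a::complete_space \<Rightarrow> nat \<Rightarrow> 'a" and a l +
  fixes net :: "int \<Rightarrow> 'a set" and par :: "int \<Rightarrow> 'a \<Rightarrow> 'a" and root :: 'a
    and top :: "nat \<Rightarrow> int" and \<theta> :: real and N :: nat
  assumes theta_pos: "0 < \<theta>" and theta_less: "\<theta> < 1"
    and net_near: "\<And>k x. \<exists>c\<in>net k. dist c x \<le> a k"
    and net_card: "\<And>k x. finite (net k \<inter> cball x (3 * a k)) \<and> card (net k \<inter> cball x (3 * a k)) \<le> N"
    and root_net: "root \<in> net k"
    and par_net: "c \<in> net (k + 1) \<Longrightarrow> par k c \<in> net k"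
    and par_dist: "c \<in> net (k + 1) \<Longrightarrow> dist (par k c) c \<le> a k"
    and par_root: "c \<in> net (k + 1) \<Longrightarrow> 2 * dist c root < a k \<Longrightarrow> par k c = root"
    and sel_net: "\<And>n k y i. top n \<le> k \<Longrightarrow> y \<in> net k \<Longrightarrow> sel k y i \<in> net (k + 1)"
    and sel_par: "\<And>n k y i. top n \<le> k \<Longrightarrow> y \<in> net k \<Longrightarrow> par k (sel k y i) = y"
    and sel_prob: "\<And>n k y c. top n \<le> k \<Longrightarrow> y \<in> net k \<Longrightarrow> measure_pmf.prob Q {i. sel k y i = c} \<le> \<theta>"
    and sel_surj: "\<And>n k c. top n \<le> k \<Longrightarrow> c \<in> net (k + 1) \<Longrightarrow> \<exists>i\<in>set_pmf Q. sel k (par k c) i = c"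
    and sel_root: "\<And>n k. top n \<le> k \<Longrightarrow> sel k root 0 = root" and Q_0: "pmf Q 0 = \<theta>"
    and top_decseq: "decseq top"
    and top_root: "\<And>k c. 0 < k \<Longrightarrow> \<exists>n. top n < k \<and> (net (top n) = {root} \<or> 4 * dist c root < a (top n))"
begin

section \<open>Ancestors and upper bounds for the laws\<close>

primrec anc :: "nat \<Rightarrow> int \<Rightarrow> 'a \<Rightarrow> 'a" where
  "anc 0 k c = c"
| "anc (Suc n) k c = par k (anc n (k + 1) c)"

lemma anc_net: "c \<in> net (k + int n) \<Longrightarrow> anc n k c \<in> net k"
proof (induction n arbitrary: k)
  case (Suc n)
  have "k + int (Suc n) = k + 1 + int n" by simp
  then have "anc n (k + 1) c \<in> net (k + 1)"
    using Suc.prems by (intro Suc.IH) metis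
  then show ?case
    using par_net by simp
qed simp

lemma dist_anc: "c \<in> net (k + int n) \<Longrightarrow> dist (anc n k c) c \<le> 2 * a k"
proof (induction n arbitrary: k)
  case 0
  then show ?case using a_pos[of k] by simp
next
  case (Suc n)
  have "k + int (Suc n) = k + 1 + int n" by simp
  then have c: "c \<in> net (k + 1 + int n)"
    using Suc.prems by metis
  have "dist (anc (Suc n) k c) c \<le> dist (par k (anc n (k + 1) c)) (anc n (k + 1) c) + dist (anc n (k + 1) c) c"
    by (simp add: dist_triangle)
  also have "\<dots> \<le> a k + 2 * a (k + 1)"
    by (rule add_mono[OF par_dist[OF anc_net[OF c]] Suc.IH[OF c]])
  also have "\<dots> \<le> 2 * a k"
    using a_Suc_le[of k] a_pos[of k] by simp
  finally show ?case .
qed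

text \<open>A descent from \<open>y\<close> can reach a node \<open>c\<close> of level
  \<open>k + int n\<close> only if \<open>y\<close> is its ancestor, and then with probability at
  most \<open>\<theta> ^ n\<close>, one factor per level. Nodes outside \<open>S\<close> do not
  charge \<open>B\<close>, so a union bound over the reachable nodes of \<open>S\<close>
  remains.\<close>

lemma law_le_card_anc:
  assumes "finite S" "S \<subseteq> net (k + int n)" "B \<in> sets borel"
    and "\<And>c. c \<in> net (k + int n) - S \<Longrightarrow> emeasure (law (k + int n) c) B = 0"
    and "y \<in> net k" "top j \<le> k"
  shows "emeasure (law k y) B \<le> ennreal (real (card {c\<in>S. anc n k c = y}) * \<theta> ^ n)"
  using assms
proof (induction n arbitrary: k y)
  case 0
  show ?case
  proof (cases "y \<in> S")
    case True
    then have "{c \<in> S. anc 0 k c = y} = {y}" by auto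
    then show ?thesis using law_le_1[of k y B] by simp
  next
    case False
    then show ?thesis using 0 by simp
  qed
next
  case (Suc n)
  have eq: "k + int (Suc n) = (k + 1) + int n" by simp
  have sub: "S \<subseteq> net ((k + 1) + int n)"
    using Suc.prems(2) unfolding eq .
  have IH: "emeasure (law (k + 1) (sel k y i)) B
      \<le> ennreal (real (card {c\<in>S. anc n (k + 1) c = sel k y i}) * \<theta> ^ n)" for i
    using Suc.prems sel_net[of j k y i] unfolding eq by (intro Suc.IH) auto
  \<comment> \<open>Writing the count as a sum of indicators turns its expectation over the first
    index into a sum of selection probabilities.\<close>
  have card: "ennreal (real (card {c\<in>S. anc n (k + 1) c = sel k y i}) * \<theta> ^ n)
      = (\<Sum>c\<in>S. ennreal (\<theta> ^ n) * indicator {i. sel k y i = anc n (k + 1) c} i)" for i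
  proof -
    have "real (card {c\<in>S. anc n (k + 1) c = sel k y i}) = (\<Sum>c\<in>S. if anc n (k + 1) c = sel k y i then 1 else 0)"
      using Suc.prems(1) by (simp flip: sum.inter_filter)
    then have "ennreal (real (card {c\<in>S. anc n (k + 1) c = sel k y i}) * \<theta> ^ n)
        = ennreal (\<Sum>c\<in>S. if anc n (k + 1) c = sel k y i then \<theta> ^ n else 0)"
      by (simp add: sum_distrib_right if_distribR mult_if_delta if_distrib[of "\<lambda>x. x * _"] cong: if_cong)
    also have "\<dots> = (\<Sum>c\<in>S. ennreal (if anc n (k + 1) c = sel k y i then \<theta> ^ n else 0))"
      using theta_pos by (intro sum_ennreal[symmetric]) auto
    also have "\<dots> = (\<Sum>c\<in>S. ennreal (\<theta> ^ n) * indicator {i. sel k y i = anc n (k + 1) c} i)"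
      by (intro sum.cong) (auto simp: indicator_def)
    finally show ?thesis .
  qed
  \<comment> \<open>If the level \<open>k\<close> ancestor of \<open>c\<close> is not
    \<open>y\<close>, no index leads from \<open>y\<close> to the level \<open>k + 1\<close>
    ancestor of \<open>c\<close>, since every selected child has parent \<open>y\<close>.\<close>
  have prob: "measure_pmf.prob Q {i. sel k y i = anc n (k + 1) c}
      \<le> (if anc (Suc n) k c = y then \<theta> else 0)" for c
  proof (cases "anc (Suc n) k c = y")
    case True
    then show ?thesis using sel_prob Suc.prems by simp
  next
    case False
    then have "{i. sel k y i = anc n (k + 1) c} = {}"
      using sel_par[of j k y] Suc.prems by (auto dest!: sym[of "sel k y _"])
    then show ?thesis using False by simp
  qed
  have "emeasure (law k y) B = (\<integral>\<^sup>+i. emeasure (law (k + 1) (sel k y i)) B \<partial>measure_pmf Q)"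
    using Suc.prems by (intro law_step)
  also have "\<dots> \<le> (\<integral>\<^sup>+i. ennreal (real (card {c\<in>S. anc n (k + 1) c = sel k y i}) * \<theta> ^ n) \<partial>measure_pmf Q)"
    by (intro nn_integral_mono IH)
  also have "\<dots> = (\<Sum>c\<in>S. ennreal (\<theta> ^ n) * emeasure (measure_pmf Q) {i. sel k y i = anc n (k + 1) c})"
    unfolding card by (subst nn_integral_sum) (simp_all add: nn_integral_cmult_indicator)
  also have "\<dots> \<le> (\<Sum>c\<in>S. ennreal (\<theta> ^ n) * ennreal (if anc (Suc n) k c = y then \<theta> else 0))"
    unfolding measure_pmf.emeasure_eq_measure by (intro sum_mono mult_left_mono ennreal_leI prob) simp
  also have "\<dots> = (\<Sum>c\<in>S. ennreal (if anc (Suc n) k c = y then \<theta> ^ Suc n else 0))"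
    using theta_pos by (intro sum.cong) (auto simp: ennreal_mult ac_simps)
  also have "\<dots> = ennreal (\<Sum>c\<in>S. if anc (Suc n) k c = y then \<theta> ^ Suc n else 0)"
    using theta_pos by (intro sum_ennreal) auto
  also have "(\<Sum>c\<in>S. if anc (Suc n) k c = y then \<theta> ^ Suc n else 0)
      = real (card {c\<in>S. anc (Suc n) k c = y}) * \<theta> ^ Suc n"
    using Suc.prems(1) by (simp flip: sum.inter_filter)
  finally show ?case .
qed

text \<open>The law started at \<open>c\<close> stays within twice the scale of \<open>c\<close>, so
  only net points within \<open>3 * a (k + int n)\<close> of \<open>x\<close> charge the ball, and
  \<open>net_card\<close> bounds their number.\<close>

lemma law_cball_le:
  assumes "y \<in> net k" "top j \<le> k" "r \<le> a (k + int n)"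
  shows "emeasure (law k y) (cball x r) \<le> ennreal (real N * \<theta> ^ n)"
proof -
  let ?S = "net (k + int n) \<inter> cball x (3 * a (k + int n))"
  have fin: "finite ?S" and card: "card ?S \<le> N"
    using net_card by auto
  have "emeasure (law k y) (cball x r) \<le> ennreal (real (card {c\<in>?S. anc n k c = y}) * \<theta> ^ n)"
  proof (rule law_le_card_anc[OF fin])
    fix c assume "c \<in> net (k + int n) - ?S"
    then have "3 * a (k + int n) < dist x c"
      by auto
    then have "cball c (2 * a (k + int n)) \<inter> cball x r = {}"
      using assms(3) by (auto simp: disjoint_iff) (smt (verit) dist_triangle2)
    then show "emeasure (law (k + int n) c) (cball x r) = 0"
      by (intro law_eq_0) auto
  qed (use assms in auto)
  moreover have "card {c\<in>?S. anc n k c = y} \<le> N"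
    by (rule order_trans[OF card_mono[OF fin] card]) auto
  then have "real (card {c\<in>?S. anc n k c = y}) * \<theta> ^ n \<le> real N * \<theta> ^ n"
    using theta_pos by (intro mult_right_mono) auto
  ultimately show ?thesis
    using ennreal_leI order_trans by blast
qed

text \<open>No doubling property of the measure is needed: by induction on the starting level, it suffices to
  start at a level \<open>k\<close> with \<open>r + 4 * a k \<le> R\<close>, where the law lives either inside \<open>cball x R\<close> or
  outside \<open>cball x r\<close>.\<close>

lemma law_cball_homogeneous:
  assumes "y \<in> net k" "top j \<le> k" "r \<le> a (k + int m + int n)" "r + 4 * a (k + int m) \<le> R"
  shows "emeasure (law k y) (cball x r) \<le> ennreal (real N * \<theta> ^ n) * emeasure (law k y) (cball x R)"
  using assms
proof (induction m arbitrary: k y)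
  case 0
  show ?case
  proof (cases "cball y (2 * a k) \<inter> cball x r = {}")
    case True
    have "emeasure (law k y) (cball x r) = 0"
      by (rule law_eq_0[OF True]) simp
    then show ?thesis by simp
  next
    case False
    then obtain z where z: "dist y z \<le> 2 * a k" "dist x z \<le> r"
      unfolding disjoint_iff mem_cball by blast
    \<comment> \<open>Points of the ball around \<open>y\<close> are within \<open>4 * a k\<close>
      of \<open>z\<close>, hence within \<open>r + 4 * a k\<close> of \<open>x\<close>.\<close>
    have "cball y (2 * a k) \<subseteq> cball x R"
    proof
      fix w assume "w \<in> cball y (2 * a k)"
      then have "dist y w \<le> 2 * a k"
        by simp
      then have "dist x w \<le> R"
        using z 0(4) dist_triangle[of x w z] dist_triangle3[of z w y] by simp
      then show "w \<in> cball x R"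
        by simp
    qed
    then have "emeasure (law k y) (cball x R) = 1"
      by (rule law_eq_1) simp
    moreover have "emeasure (law k y) (cball x r) \<le> ennreal (real N * \<theta> ^ n)"
      using 0(3) by (intro law_cball_le[OF 0(1,2)]) simp
    ultimately show ?thesis
      by simp
  qed
next
  case (Suc m)
  have eq: "k + int (Suc m) = k + 1 + int m" by simp
  have IH: "emeasure (law (k + 1) (sel k y i)) (cball x r)
      \<le> ennreal (real N * \<theta> ^ n) * emeasure (law (k + 1) (sel k y i)) (cball x R)" for i
    using Suc.prems(3,4) sel_net[OF Suc.prems(2,1), of i] Suc.prems(2) unfolding eq by (intro Suc.IH) simp_all
  \<comment> \<open>Both sides are averages over the same random child, up to a constant factor, so
    the bound for the children passes to \<open>y\<close>.\<close>
  have "emeasure (law k y) (cball x r) = (\<integral>\<^sup>+i. emeasure (law (k + 1) (sel k y i)) (cball x r) \<partial>measure_pmf Q)"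
    by (intro law_step) simp
  also have "\<dots> \<le> (\<integral>\<^sup>+i. ennreal (real N * \<theta> ^ n) * emeasure (law (k + 1) (sel k y i)) (cball x R) \<partial>measure_pmf Q)"
    by (intro nn_integral_mono IH)
  also have "\<dots> = ennreal (real N * \<theta> ^ n) * emeasure (law k y) (cball x R)"
    unfolding law_step[OF closed_cball[THEN borel_closed], of k y x R] by (intro nn_integral_cmult) simp
  finally show ?case .
qed

section \<open>Lower bounds for the laws\<close>

lemma law_ge_sel:
  assumes "B \<in> sets borel"
  shows "ennreal (pmf Q i) * emeasure (law (k + 1) (sel k y i)) B \<le> emeasure (law k y) B"
proof -
  let ?e = "\<lambda>j. emeasure (law (k + 1) (sel k y j)) B"
  have "ennreal (pmf Q i) * ?e i = ?e i * emeasure (measure_pmf Q) {i}"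
    by (simp only: emeasure_pmf_single mult.commute)
  also have "\<dots> = (\<integral>\<^sup>+j. ?e i * indicator {i} j \<partial>measure_pmf Q)"
    by (rule nn_integral_cmult_indicator[symmetric]) simp
  also have "\<dots> \<le> (\<integral>\<^sup>+j. ?e j \<partial>measure_pmf Q)"
  proof (rule nn_integral_mono)
    show "?e i * indicator {i} j \<le> ?e j" for j
      by (cases "j = i") simp_all
  qed
  also have "\<dots> = emeasure (law k y) B"
    by (rule law_step[OF assms, symmetric])
  finally show ?thesis .
qed

text \<open>Index \<open>0\<close> keeps the descent at \<open>root\<close>; doing this
  \<open>n\<close> times in succession has probability \<open>\<theta> ^ n\<close>.\<close>

lemma law_root_ge:
  assumes "B \<in> sets borel" "top j \<le> k"
  shows "ennreal (\<theta> ^ n) * emeasure (law (k + int n) root) B \<le> emeasure (law k root) B"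
  using assms(2)
proof (induction n arbitrary: k)
  case (Suc n)
  have "ennreal (\<theta> ^ Suc n) * emeasure (law (k + int (Suc n)) root) B
      = ennreal \<theta> * (ennreal (\<theta> ^ n) * emeasure (law (k + 1 + int n) root) B)"
  proof -
    have "k + int (Suc n) = k + 1 + int n" by simp
    then show ?thesis
      using theta_pos by (simp only: power_Suc ennreal_mult'' mult.assoc zero_le_power less_imp_le)
  qed
  also have "\<dots> \<le> ennreal \<theta> * emeasure (law (k + 1) root) B"
    using Suc.prems by (intro mult_left_mono Suc.IH) auto
  also have "\<dots> \<le> emeasure (law k root) B"
    using law_ge_sel[OF assms(1), of 0 k root] unfolding sel_root[OF Suc.prems] Q_0 .
  finally show ?case .
qed simp

text \<open>Every edge of the tree has positive probability by \<open>sel_surj\<close>, hence so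
  does the path from the ancestor down to \<open>c\<close>.\<close>

lemma law_anc_pos:
  assumes "B \<in> sets borel" "top j \<le> k" "c \<in> net (k + int n)" "0 < emeasure (law (k + int n) c) B"
  shows "0 < emeasure (law k (anc n k c)) B"
  using assms(2-)
proof (induction n arbitrary: k)
  case (Suc n)
  have eq: "k + int (Suc n) = k + 1 + int n" by simp
  have c: "c \<in> net (k + 1 + int n)"
    using Suc.prems(2) unfolding eq .
  have pos: "0 < emeasure (law (k + 1) (anc n (k + 1) c)) B"
    using Suc.prems unfolding eq by (intro Suc.IH) auto
  define y where "y = anc (Suc n) k c"
  obtain i where i: "i \<in> set_pmf Q" "sel k y i = anc n (k + 1) c"
    using sel_surj[OF Suc.prems(1) anc_net[OF c]] unfolding y_def anc.simps by blast
  have "0 < ennreal (pmf Q i) * emeasure (law (k + 1) (sel k y i)) B"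
    using pos i by (simp add: ennreal_zero_less_mult_iff pmf_positive)
  also have "\<dots> \<le> emeasure (law k y) B"
    by (rule law_ge_sel[OF assms(1)])
  finally show ?case
    unfolding y_def .
qed simp

text \<open>In the second case the level \<open>k + 1\<close> ancestor of \<open>c\<close> is within
  \<open>2 * a (k + 1)\<close>, at most \<open>a k / 4\<close>, of \<open>c\<close>. As
  \<open>c\<close> is closer than \<open>a k / 4\<close> to \<open>root\<close>, this ancestor is
  closer than \<open>a k / 2\<close> to \<open>root\<close>, and \<open>par_root\<close> applies to
  the final parent step, which \<open>Suc n\<close> provides.\<close>

lemma anc_root:
  assumes "net k = {root} \<or> 4 * dist c root < a k" "c \<in> net (k + int (Suc n))"
  shows "anc (Suc n) k c = root"
  using assms(1)
proof
  assume "net k = {root}"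
  then show ?thesis using anc_net[OF assms(2)] by (simp del: anc.simps)
next
  assume *: "4 * dist c root < a k"
  have "k + int (Suc n) = k + 1 + int n" by simp
  then have c: "c \<in> net (k + 1 + int n)"
    using assms(2) by metis
  have "dist (anc n (k + 1) c) root \<le> 2 * a (k + 1) + dist c root"
    using dist_anc[OF c] dist_triangle[of "anc n (k + 1) c" root c] by linarith
  then have "2 * dist (anc n (k + 1) c) root < a k"
    using a_Suc_le[of k] * by linarith
  then show ?thesis
    using par_root[OF anc_net[OF c]] by simp
qed

text \<open>Since the root selects itself with probability \<open>\<theta>\<close>, the normalisation makes \<open>mass\<close> increasing.\<close>

definition mass :: "nat \<Rightarrow> 'a measure" where
  "mass n = scale_measure (ennreal (\<theta> powi top n)) (law (top n) root)"

definition \<mu> :: "'a measure" where "\<mu> = (SUP n. mass n)"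

lemma sets_mass [simp]: "sets (mass n) = sets borel"
  by (simp add: mass_def)

lemma emeasure_mass: "emeasure (mass n) B = ennreal (\<theta> powi top n) * emeasure (law (top n) root) B"
  by (simp add: mass_def)

lemma mass_mono:
  assumes "i \<le> j"
  shows "mass i \<le> mass j"
proof -
  have "emeasure (mass i) B \<le> emeasure (mass j) B" if B: "B \<in> sets borel" for B
  proof -
    define m where "m = nat (top i - top j)"
    have i: "top i = top j + int m"
      using decseqD[OF top_decseq assms] by (simp add: m_def)
    have "emeasure (mass i) B = ennreal (\<theta> powi top j) * (ennreal (\<theta> ^ m) * emeasure (law (top j + int m) root) B)"
      using theta_pos by (simp add: emeasure_mass i power_int_add ennreal_mult mult.assoc)
    also have "\<dots> \<le> emeasure (mass j) B"
      unfolding emeasure_mass by (intro mult_left_mono law_root_ge[OF B order_refl]) simp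
    finally show ?thesis .
  qed
  then show ?thesis
    by (subst le_measure) auto
qed

lemma sets_\<mu> [simp]: "sets \<mu> = sets borel"
  unfolding \<mu>_def by (rule sets_SUP) auto

text \<open>The masses form a chain, and for chains the supremum of measures is taken
  setwise.\<close>

lemma emeasure_\<mu>:
  assumes "B \<in> sets borel"
  shows "emeasure \<mu> B = (SUP n. emeasure (mass n) B)"
  unfolding \<mu>_def
proof (rule emeasure_SUP_chain[where N = borel])
  show "Complete_Partial_Order.chain (\<le>) (range mass)"
    using mass_mono by (auto simp: chain_def) (metis nle_le)
qed (use assms in auto)

lemma mass_le: "B \<in> sets borel \<Longrightarrow> emeasure (mass n) B \<le> emeasure \<mu> B"
  by (subst emeasure_\<mu>) (auto intro: SUP_upper)

lemma mass_emono: "i \<le> j \<Longrightarrow> B \<in> sets borel \<Longrightarrow> emeasure (mass i) B \<le> emeasure (mass j) B"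
  using mass_mono[of i j] le_measure[of "mass i" "mass j"] by simp

section \<open>Ball estimates for the limit measure\<close>

lemma \<mu>_homogeneous:
  assumes "top j \<le> k" "r \<le> a (k + int n)" "r + 4 * a k \<le> R"
  shows "emeasure \<mu> (cball x r) \<le> ennreal (real N * \<theta> ^ n) * emeasure \<mu> (cball x R)"
proof -
  have *: "emeasure (mass i) (cball x r) \<le> ennreal (real N * \<theta> ^ n) * emeasure \<mu> (cball x R)" if "j \<le> i" for i
  proof -
    define m where "m = nat (k - top i)"
    have k: "k = top i + int m"
      using decseqD[OF top_decseq that] assms(1) by (simp add: m_def)
    have "emeasure (mass i) (cball x r) \<le> ennreal (\<theta> powi top i) *
        (ennreal (real N * \<theta> ^ n) * emeasure (law (top i) root) (cball x R))"
      unfolding emeasure_mass using assms root_net unfolding k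
      by (intro mult_left_mono law_cball_homogeneous) auto
    also have "\<dots> = ennreal (real N * \<theta> ^ n) * emeasure (mass i) (cball x R)"
      by (simp add: emeasure_mass ac_simps)
    also have "\<dots> \<le> ennreal (real N * \<theta> ^ n) * emeasure \<mu> (cball x R)"
      by (intro mult_left_mono mass_le) auto
    finally show ?thesis .
  qed
  \<comment> \<open>For \<open>i < j\<close> the start may be finer than level \<open>k\<close>;
    monotonicity of \<open>mass\<close> replaces \<open>i\<close> by \<open>max i j\<close>.\<close>
  have "emeasure (mass i) (cball x r) \<le> ennreal (real N * \<theta> ^ n) * emeasure \<mu> (cball x R)" for i
    using *[of "max i j"] mass_emono[of i "max i j" "cball x r"] by (auto intro: order_trans)
  then show ?thesis
    by (subst emeasure_\<mu>) (auto intro: SUP_least)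
qed

text \<open>Take a level \<open>k\<close> with \<open>r\<close> at most \<open>a k\<close>. A
  descent started at or above this level ends in the ball with probability at most \<open>N\<close>
  times a power of \<theta> which the normalisation completes to \<open>\<theta> powi k\<close>; a
  finer start has total mass at most \<open>\<theta> powi k\<close>. The bound is uniform in
  \<open>n\<close>, so it passes to the supremum.\<close>

lemma \<mu>_cball_finite: "emeasure \<mu> (cball x r) < \<infinity>"
proof -
  obtain m where m: "l ^ m < a 0 / (\<bar>r\<bar> + 1)"
    using real_arch_pow_inv[of "a 0 / (\<bar>r\<bar> + 1)" l] a_pos[of 0] l_le by auto
  define k where "k = - int m"
  have "(\<bar>r\<bar> + 1) * l ^ m < l ^ m * a k"
    using m a_add[of k m] by (simp add: k_def field_simps)
  then have r: "r \<le> a k"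
    using l_pos by (simp add: mult.commute)
  have "emeasure (mass n) (cball x r) \<le> ennreal ((real N + 1) * \<theta> powi k)" for n
  proof (cases "top n \<le> k")
    case True
    define p where "p = nat (k - top n)"
    have k: "k = top n + int p"
      using True by (simp add: p_def)
    have "emeasure (mass n) (cball x r) \<le> ennreal (\<theta> powi top n) * ennreal (real N * \<theta> ^ p)"
      unfolding emeasure_mass using r root_net
      by (intro mult_left_mono law_cball_le) (auto simp: k)
    also have "\<dots> = ennreal (real N * \<theta> powi k)"
      using theta_pos by (simp add: k power_int_add ennreal_mult[symmetric] ac_simps)
    also have "\<dots> \<le> ennreal ((real N + 1) * \<theta> powi k)"
      using theta_pos by (intro ennreal_leI mult_right_mono) auto
    finally show ?thesis .
  next
    case False
    have "emeasure (mass n) (cball x r) \<le> ennreal (\<theta> powi top n) * 1"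
      unfolding emeasure_mass by (intro mult_left_mono law_le_1) simp
    also have "\<dots> \<le> ennreal (1 * \<theta> powi k)"
      using False theta_pos theta_less by (auto intro!: ennreal_leI power_int_decreasing)
    also have "\<dots> \<le> ennreal ((real N + 1) * \<theta> powi k)"
      using theta_pos by (intro ennreal_leI mult_right_mono) auto
    finally show ?thesis .
  qed
  then have "emeasure \<mu> (cball x r) \<le> ennreal ((real N + 1) * \<theta> powi k)"
    by (subst emeasure_\<mu>) (auto intro: SUP_least)
  then show ?thesis
    by (simp add: le_less_trans)
qed

text \<open>A fine net point \<open>c\<close> near \<open>x\<close> has its whole law inside the
  ball, and from some starting level \<open>root\<close> is an ancestor of \<open>c\<close>; the
  descent from \<open>root\<close> then passes through \<open>c\<close> with positive
  probability.\<close>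

lemma \<mu>_cball_pos:
  assumes "0 < r"
  shows "0 < emeasure \<mu> (cball x r)"
proof -
  have "eventually (\<lambda>n. a (0 + int n) < r / 3) sequentially"
    using a_tendsto[of 0] assms by (intro order_tendstoD) auto
  \<comment> \<open>One third of \<open>r\<close> pays for the distance from \<open>x\<close> to the
    net point, two thirds for the spread of its law; \<open>0 < n\<close> is what
    \<open>top_root\<close> asks for.\<close>
  then have "eventually (\<lambda>n. a (0 + int n) < r / 3 \<and> 0 < n) sequentially"
    using eventually_gt_at_top[of 0] by eventually_elim auto
  then obtain m where m: "a (int m) < r / 3" "0 < m"
    by (auto simp: eventually_sequentially)
  obtain c where c: "c \<in> net (int m)" "dist c x \<le> a (int m)"
    using net_near by blast
  obtain n where n: "top n < int m" "net (top n) = {root} \<or> 4 * dist c root < a (top n)"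
    using top_root[of "int m" c] m(2) by auto
  \<comment> \<open>Subtracting 1 exhibits the positive level difference as \<open>Suc p\<close>,
    the form used by \<open>anc_root\<close>.\<close>
  define p where "p = nat (int m - top n) - 1"
  have p: "int m = top n + int (Suc p)"
    using n(1) by (simp add: p_def)
  have "cball c (2 * a (int m)) \<subseteq> cball x r"
  proof
    fix z assume "z \<in> cball c (2 * a (int m))"
    then show "z \<in> cball x r"
      using c(2) m(1) dist_triangle3[of x z c] by simp
  qed
  then have "emeasure (law (int m) c) (cball x r) = 1"
    by (intro law_eq_1) auto
  then have "0 < emeasure (law (top n) (anc (Suc p) (top n) c)) (cball x r)"
    using c(1) unfolding p by (intro law_anc_pos) auto
  also have "anc (Suc p) (top n) c = root"
    using c(1) n(2) unfolding p by (intro anc_root)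
  finally have "0 < emeasure (mass n) (cball x r)"
    using theta_pos by (simp add: emeasure_mass ennreal_zero_less_mult_iff)
  then show ?thesis
    using mass_le[of "cball x r" n] by (simp add: less_le_trans)
qed

lemma \<mu>_root_ge:
  assumes "top n \<le> k"
  shows "ennreal (\<theta> powi k) \<le> emeasure \<mu> (cball root (2 * a k))"
proof -
  define m where "m = nat (k - top n)"
  have k: "k = top n + int m"
    using assms by (simp add: m_def)
  have "ennreal (\<theta> powi k) = ennreal (\<theta> powi top n) * (ennreal (\<theta> ^ m) * emeasure (law (top n + int m) root) (cball root (2 * a k)))"
    using theta_pos by (subst law_eq_1) (auto simp: k power_int_add ennreal_mult)
  also have "\<dots> \<le> emeasure (mass n) (cball root (2 * a k))"
    unfolding emeasure_mass by (intro mult_left_mono law_root_ge) auto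
  also have "\<dots> \<le> emeasure \<mu> (cball root (2 * a k))"
    by (intro mass_le) simp
  finally show ?thesis .
qed

lemma a_scale_exists:
  assumes "0 < v"
  shows "\<exists>k. a (k + 1) < v \<and> v \<le> a k"
proof -
  obtain m where "l ^ m < a 0 / v"
    using real_arch_pow_inv[of "a 0 / v" l] a_pos[of 0] l_le assms by auto
  then have "v * l ^ m < l ^ m * a (- int m)"
    using a_add[of "- int m" m] assms by (simp add: field_simps)
  then have m: "v \<le> a (- int m)"
    using l_pos by (simp add: mult.commute)
  have "eventually (\<lambda>n. a (- int m + int n) < v) sequentially"
    by (rule order_tendstoD(2)[OF a_tendsto assms])
  then have ex: "\<exists>n. a (- int m + int n) < v"
    by (auto simp: eventually_sequentially)
  define n where "n = (LEAST n. a (- int m + int n) < v)"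
  have n: "a (- int m + int n) < v"
    unfolding n_def using LeastI_ex[OF ex] .
  then obtain p where p: "n = Suc p"
    using m by (cases n) auto
  have "\<not> a (- int m + int p) < v"
    using not_less_Least[of p "\<lambda>n. a (- int m + int n) < v"] p unfolding n_def by simp
  then show ?thesis
    using n unfolding p by (intro exI[of _ "- int m + int p"]) (simp add: algebra_simps)
qed

text \<open>Compare level \<open>k\<close>, the first with scale below \<open>R / 8\<close>, with
  level \<open>i = k + int n\<close>, the last with scale at least \<open>r\<close>. Then
  \<open>\<mu>_homogeneous\<close> gives the factor \<open>N * \<theta> ^ n\<close>, and
  \<open>\<theta> ^ n = (l ^ n) powr s\<close>. Rounding both radii to scales costs one power of
  \<open>l\<close> each, whence \<open>8 / l\<^sup>2\<close>. If \<open>r\<close> exceeds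
  \<open>a k\<close>, then \<open>R / r\<close> is bounded and monotonicity of the measure
  suffices.\<close>

lemma \<mu>_ball_ratio:
  assumes s: "0 < s" and theta: "\<theta> = l powr s"
    and r: "0 < r" "r < R" and adm: "\<And>k. a k < R / 8 \<Longrightarrow> \<exists>j. top j \<le> k"
  shows "ennreal (1 / ((real N + 1) * (8 / l\<^sup>2) powr s) * (R / r) powr s)
    \<le> emeasure \<mu> (cball x R) / emeasure \<mu> (cball x r)"
proof -
  define u v where "u = measure \<mu> (cball x R)" and "v = measure \<mu> (cball x r)"
  have u: "emeasure \<mu> (cball x R) = ennreal u" and v: "emeasure \<mu> (cball x r) = ennreal v"
    unfolding u_def v_def using \<mu>_cball_finite[of x] by (simp_all add: emeasure_eq_ennreal_measure top.not_eq_extremum)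
  have v_pos: "0 < v" and u_pos: "0 < u"
    using \<mu>_cball_pos[of r x] \<mu>_cball_pos[of R x] r unfolding u v by simp_all
  have "ennreal v \<le> ennreal u"
    unfolding u[symmetric] v[symmetric] using r by (intro emeasure_mono) auto
  then have vu: "v \<le> u"
    using u_pos by simp
  define K where "K = (8 / l\<^sup>2) powr s"
  have K: "1 \<le> K" "0 < K"
    unfolding K_def using l_pos l_le s power_le_one[of l 2] by (auto intro!: ge_one_powr_ge_zero)
  obtain k' where k': "a (k' + 1) < R / 8" "R / 8 \<le> a k'"
    using a_scale_exists[of "R / 8"] r by auto
  define k where "k = k' + 1"
  have ak: "a k < R / 8" "l * R / 8 \<le> a k"
    using k' a_Suc[of k'] l_pos mult_left_mono[OF k'(2), of l] by (simp_all add: k_def)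
  obtain j where j: "top j \<le> k"
    using adm ak(1) by blast
  have "(R / r) powr s * v \<le> (real N + 1) * K * u"
  proof (cases "r \<le> a k")
    case True
    obtain i where i: "a (i + 1) < r" "r \<le> a i"
      using a_scale_exists[OF r(1)] by auto
    have "k \<le> i"
      using a_mono[of "i + 1" k] i(1) True by (cases "k \<le> i") auto
    define n where "n = nat (i - k)"
    have i_eq: "i = k + int n"
      using \<open>k \<le> i\<close> by (simp add: n_def)
    have "ennreal v \<le> ennreal (real N * \<theta> ^ n) * ennreal u"
      unfolding u[symmetric] v[symmetric] using i(2) ak(1) True a_pos[of k] unfolding i_eq
      by (intro \<mu>_homogeneous[OF j]) auto
    also have "\<dots> = ennreal (real N * \<theta> ^ n * u)"
      using theta_pos u_pos by (intro ennreal_mult[symmetric]) auto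
    finally have le: "v \<le> real N * \<theta> ^ n * u"
      using theta_pos u_pos by (simp add: ennreal_le_iff)
    have "l ^ n * (l * R / 8) \<le> l ^ n * a k"
      using l_pos ak(2) by (intro mult_left_mono) auto
    also have "\<dots> = a i"
      by (simp add: i_eq a_add)
    also have "\<dots> \<le> r / l"
      using i(1) a_Suc[of i] l_pos by (simp add: field_simps)
    finally have ln: "l ^ n * (R / r) \<le> 8 / l\<^sup>2"
      using l_pos r by (simp add: field_simps power2_eq_square)
    have "\<theta> ^ n = (l ^ n) powr s"
      using l_pos by (simp add: theta powr_powr mult.commute flip: powr_realpow)
    then have "\<theta> ^ n * (R / r) powr s = (l ^ n * (R / r)) powr s"
      using l_pos r powr_mult[of "l ^ n" "R / r" s] by simp
    also have "\<dots> \<le> K"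
      unfolding K_def using l_pos r s ln by (intro powr_mono2) auto
    finally have "\<theta> ^ n * (R / r) powr s \<le> K" .
    then have "real N * u * (\<theta> ^ n * (R / r) powr s) \<le> (real N + 1) * u * K"
      using u_pos theta_pos by (intro mult_mono) auto
    moreover have "(R / r) powr s * v \<le> (R / r) powr s * (real N * \<theta> ^ n * u)"
      using le by (intro mult_left_mono) auto
    ultimately show ?thesis
      by (simp add: ac_simps)
  next
    case False
    have "R / r \<le> 8 / l"
      using False ak(2) r l_pos by (simp add: field_simps)
    also have "\<dots> \<le> 8 / l\<^sup>2"
      using l_pos l_le by (intro divide_left_mono) (auto simp: power2_eq_square mult_le_one intro: mult_left_le_one_le)
    finally have "(R / r) powr s \<le> 1 * K"
      unfolding K_def using r s by (simp add: powr_mono2)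
    also have "\<dots> \<le> (real N + 1) * K"
      using K by (intro mult_right_mono) auto
    finally show ?thesis
      using vu v_pos K by (intro mult_mono) auto
  qed
  moreover have "0 < (real N + 1) * K"
    using K by simp
  ultimately have "1 / ((real N + 1) * K) * (R / r) powr s \<le> u / v"
    using v_pos pos_divide_le_eq[of "(real N + 1) * K" "(R / r) powr s" "u / v"]
    by (simp add: pos_le_divide_eq mult.commute)
  then show ?thesis
    unfolding u v K_def using u_pos v_pos by (simp add: divide_ennreal ennreal_leI)
qed

text \<open>With \<open>R\<close> fixed and \<open>r = 2 * a (int n)\<close>, the lower bound
  \<open>\<theta> ^ n\<close> for the ball at \<open>root\<close> lets the ratio grow at most like
  \<open>l powr (- s * n)\<close>, while the exponent \<alpha> demands growth
  \<open>l powr (- \<alpha> * n)\<close>. For \<alpha> above \<open>s\<close> this would bound a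
  positive constant by \<open>V * q ^ n\<close> with \<open>q < 1\<close>.\<close>

lemma root_exponent_le:
  assumes s: "0 < s" and theta: "\<theta> = l powr s" and R: "0 < R" and C: "0 < C"
    and top: "top j \<le> 0"
    and ratio: "\<And>r. 0 < r \<Longrightarrow> r < R \<Longrightarrow>
      ennreal (C * (R / r) powr \<alpha>) \<le> emeasure \<mu> (cball root R) / emeasure \<mu> (cball root r)"
  shows "\<alpha> \<le> s"
proof (rule ccontr)
  assume "\<not> \<alpha> \<le> s"
  then have \<alpha>: "s < \<alpha>" by simp
  define V where "V = measure \<mu> (cball root R)"
  have V: "emeasure \<mu> (cball root R) = ennreal V" "0 \<le> V"
    unfolding V_def using \<mu>_cball_finite[of root] by (simp_all add: emeasure_eq_ennreal_measure top.not_eq_extremum)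
  define q where "q = l powr (\<alpha> - s)"
  define c where "c = C * (R / (2 * a 0)) powr \<alpha>"
  have c: "0 < c"
    using C R a_pos[of 0] by (simp add: c_def)
  have le: "c \<le> V * q ^ n" if n: "2 * a (int n) < R" for n
  proof -
    have an: "a (int n) = l ^ n * a 0"
      using a_add[of 0 n] by simp
    have th: "ennreal (\<theta> ^ n) \<le> emeasure \<mu> (cball root (2 * a (int n)))"
      using \<mu>_root_ge[of j "int n"] top by simp
    define w where "w = measure \<mu> (cball root (2 * a (int n)))"
    have w: "emeasure \<mu> (cball root (2 * a (int n))) = ennreal w"
      unfolding w_def using \<mu>_cball_finite[of root]
      by (simp add: emeasure_eq_ennreal_measure top.not_eq_extremum)
    have wth: "\<theta> ^ n \<le> w"
      using th theta_pos unfolding w by (simp add: w_def)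
    then have "0 < w"
      using theta_pos zero_less_power[of \<theta> n] by linarith
    have "ennreal (C * (R / (2 * a (int n))) powr \<alpha>) \<le> ennreal V / ennreal w"
      using ratio[of "2 * a (int n)"] n a_pos unfolding V w by simp
    also have "\<dots> = ennreal (V / w)"
      using V \<open>0 < w\<close> by (intro divide_ennreal) auto
    finally have "C * (R / (2 * a (int n))) powr \<alpha> \<le> V / w"
      using V \<open>0 < w\<close> by (simp add: ennreal_le_iff)
    also have "\<dots> \<le> V / \<theta> ^ n"
      using V theta_pos \<open>0 < w\<close> wth by (intro divide_left_mono) auto
    finally have "C * (R / (2 * a (int n))) powr \<alpha> \<le> V / \<theta> ^ n" .
    moreover have "(R / (2 * a (int n))) powr \<alpha> = (R / (2 * a 0)) powr \<alpha> / (l powr \<alpha>) ^ n"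
    proof -
      have "R / (2 * a (int n)) = (R / (2 * a 0)) / l ^ n"
        by (simp add: an)
      then have "(R / (2 * a (int n))) powr \<alpha> = ((R / (2 * a 0)) / l ^ n) powr \<alpha>"
        by (rule arg_cong)
      also have "\<dots> = (R / (2 * a 0)) powr \<alpha> / (l ^ n) powr \<alpha>"
        by (rule powr_divide)
      also have "(l ^ n) powr \<alpha> = (l powr \<alpha>) ^ n"
        using l_pos by (simp add: powr_powr mult.commute flip: powr_realpow)
      finally show ?thesis .
    qed
    ultimately have "c / (l powr \<alpha>) ^ n \<le> V / \<theta> ^ n"
      by (simp add: c_def)
    then have "c \<le> V * ((l powr \<alpha>) ^ n / \<theta> ^ n)"
      using l_pos theta_pos by (simp add: field_simps)
    also have "(l powr \<alpha>) ^ n / \<theta> ^ n = q ^ n"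
      by (simp add: q_def theta powr_diff power_divide)
    finally show ?thesis .
  qed
  have q: "0 < q" "q < 1"
    unfolding q_def using l_pos l_le \<alpha> powr_less_mono2[of "\<alpha> - s" l 1] by auto
  then have "(\<lambda>n. V * q ^ n) \<longlonglongrightarrow> V * 0"
    by (intro tendsto_intros LIMSEQ_realpow_zero) auto
  then have "eventually (\<lambda>n. V * q ^ n < c) sequentially"
    using c by (intro order_tendstoD) auto
  moreover have "eventually (\<lambda>n. a (0 + int n) < R / 2) sequentially"
    using R by (intro order_tendstoD(2)[OF a_tendsto]) simp
  ultimately have "eventually (\<lambda>n. V * q ^ n < c \<and> a (0 + int n) < R / 2) sequentially"
    by (rule eventually_conj)
  then obtain n where "V * q ^ n < c" "a (0 + int n) < R / 2"
    by (auto simp: eventually_sequentially)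
  then show False
    using le[of n] by simp
qed

end

section \<open>Separated sets and covering numbers\<close>

definition separated :: "real \<Rightarrow> 'a::metric_space set \<Rightarrow> bool" where
  "separated \<rho> X \<longleftrightarrow> (\<forall>x\<in>X. \<forall>y\<in>X. x \<noteq> y \<longrightarrow> \<rho> \<le> dist x y)"

text \<open>Zorn's lemma: two points in the union of a chain lie in a common member, and a point at
  distance at least \<rho> from a maximal set could be added to it.\<close>

lemma maximal_separated_exists:
  fixes x0 :: "'a::metric_space"
  assumes "0 < \<rho>"
  shows "\<exists>X. x0 \<in> X \<and> separated \<rho> X \<and> (\<forall>x. \<exists>y\<in>X. dist y x < \<rho>)"
proof -
  let ?A = "{X. x0 \<in> X \<and> separated \<rho> X}"
  have "\<exists>M\<in>?A. \<forall>X\<in>?A. M \<subseteq> X \<longrightarrow> X = M"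
  proof (rule subset_Zorn_nonempty)
    show "?A \<noteq> {}"
      by (auto simp: separated_def intro!: exI[of _ "{x0}"])
    fix \<C> assume C: "\<C> \<noteq> {}" "subset.chain ?A \<C>"
    have "\<rho> \<le> dist x y" if "X \<in> \<C>" "Y \<in> \<C>" "x \<in> X" "y \<in> Y" "x \<noteq> y" for X Y x y
    proof -
      have "X \<subseteq> Y \<or> Y \<subseteq> X" and "separated \<rho> X" "separated \<rho> Y"
        using C(2) that(1,2) by (auto simp: subset_chain_def)
      then show ?thesis
        using that(3-) unfolding separated_def by blast
    qed
    then have "separated \<rho> (\<Union>\<C>)"
      unfolding separated_def by blast
    moreover have "x0 \<in> \<Union>\<C>"
      using C by (auto simp: subset_chain_def)
    ultimately show "\<Union>\<C> \<in> ?A" by simp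
  qed
  then obtain M where M: "x0 \<in> M" "separated \<rho> M" "\<And>X. x0 \<in> X \<Longrightarrow> separated \<rho> X \<Longrightarrow> M \<subseteq> X \<Longrightarrow> X = M"
    by blast
  have "\<exists>y\<in>M. dist y x < \<rho>" for x
  proof (rule ccontr)
    assume *: "\<not> (\<exists>y\<in>M. dist y x < \<rho>)"
    then have far: "\<And>y. y \<in> M \<Longrightarrow> \<rho> \<le> dist y x"
      by (simp add: not_less)
    have "separated \<rho> (insert x M)"
      using M(2) far by (auto simp: separated_def dist_commute)
    then have "insert x M = M"
      using M(1) by (intro M(3)) auto
    then have "x \<in> M" by auto
    then show False
      using * assms by (metis dist_self)
  qed
  then show ?thesis
    using M by blast
qed

text \<open>Two points of \<open>X\<close> both closer than \<open>\<rho> / 2\<close> to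
  \<open>c\<close> would violate separation, so at most one such \<open>z\<close> exists. Preferring
  it makes the parent of \<open>c\<close> canonical whenever \<open>c\<close> is well inside a
  cube.\<close>

lemma nearest_in_separated:
  assumes "separated \<rho> X" "\<forall>x. \<exists>y\<in>X. dist y x < \<rho>"
  shows "\<exists>y\<in>X. dist y c < \<rho> \<and> (\<forall>z\<in>X. 2 * dist c z < \<rho> \<longrightarrow> y = z)"
proof (cases "\<exists>z\<in>X. 2 * dist c z < \<rho>")
  case True
  then obtain z where z: "z \<in> X" "2 * dist c z < \<rho>" by blast
  have "z = w" if "w \<in> X" "2 * dist c w < \<rho>" for w
  proof (rule ccontr)
    assume "z \<noteq> w"
    then have "\<rho> \<le> dist z w"
      using assms(1) z(1) that(1) by (auto simp: separated_def)
    also have "\<dots> \<le> dist c z + dist c w"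
      by (rule dist_triangle3)
    finally show False
      using z(2) that(2) by simp
  qed
  moreover have "dist c z < \<rho>"
    using z(2) zero_le_dist[of c z] by linarith
  ultimately show ?thesis
    using z(1) by (metis dist_commute)
next
  case False
  then show ?thesis
    using assms(2) by blast
qed

lemma cover_num_le:
  assumes "finite F" "cball x R \<subseteq> (\<Union>y\<in>F. cball y r)"
  shows "cover_num x R r \<le> enat (card F)"
  unfolding cover_num_def using assms by (intro INF_lower) auto

lemma cover_num_attained:
  assumes "cover_num x R r \<le> enat n"
  shows "\<exists>F. finite F \<and> card F \<le> n \<and> cball x R \<subseteq> (\<Union>y\<in>F. cball y r)"
proof -
  \<comment> \<open>A strict upper bound on the infimum yields an actual cover.\<close>
  have "cover_num x R r < enat (Suc n)"
    using assms by (simp add: le_less_trans)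
  then obtain F where "finite F" "cball x R \<subseteq> (\<Union>y\<in>F. cball y r)" "enat (card F) < enat (Suc n)"
    unfolding cover_num_def by (auto simp: INF_less_iff)
  then show ?thesis
    by (intro exI[of _ F]) auto
qed

text \<open>A ball of radius \<open>\<rho> / 3\<close> contains at most one point of a
  \<rho>-separated set. Covering by such balls bounds the number of points by
  \<open>C * (3 * T) powr \<alpha>\<close>, which depends neither on the centre nor on the
  scale.\<close>

lemma card_separated_le:
  assumes "assouad_dim TYPE('a::metric_space) < \<infinity>" and T: "1 \<le> T"
  shows "\<exists>N. \<forall>\<rho> X (x::'a). 0 < \<rho> \<longrightarrow> separated \<rho> X \<longrightarrow>
    finite (X \<inter> cball x (T * \<rho>)) \<and> card (X \<inter> cball x (T * \<rho>)) \<le> N"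
proof -
  have "\<exists>\<alpha> C. \<forall>(x::'a) r R. 0 < r \<and> r < R \<longrightarrow>
      ereal_of_enat (cover_num x R r) \<le> ereal (C * (R / r) powr \<alpha>)"
  \<comment> \<open>Without an admissible exponent the infimum runs over the empty set and is
    infinite.\<close>
  proof (rule ccontr)
    assume no: "\<not> ?thesis"
    have "{ereal \<alpha> | \<alpha>. 0 \<le> \<alpha> \<and> (\<exists>C>0. \<forall>(x::'a) r R. 0 < r \<and> r < R \<longrightarrow>
        ereal_of_enat (cover_num x R r) \<le> ereal (C * (R / r) powr \<alpha>))} = {}"
      using no by blast
    then have "assouad_dim TYPE('a) = \<infinity>"
      unfolding assouad_dim_def by (simp only: Inf_empty top_ereal_def)
    then show False
      using assms(1) by simp
  qed
  then obtain \<alpha> C where C': "\<forall>(x::'a) r R. 0 < r \<and> r < R \<longrightarrow>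
      ereal_of_enat (cover_num x R r) \<le> ereal (C * (R / r) powr \<alpha>)"
    by (elim exE)
  have C: "ereal_of_enat (cover_num x R r) \<le> ereal (C * (R / r) powr \<alpha>)" if "0 < r" "r < R" for x :: 'a and r R
    using C' that by simp
  define N where "N = nat \<lceil>C * (3 * T) powr \<alpha>\<rceil>"
  have "finite (X \<inter> cball x (T * \<rho>)) \<and> card (X \<inter> cball x (T * \<rho>)) \<le> N"
    if \<rho>: "0 < \<rho>" and X: "separated \<rho> X" for \<rho> X and x :: 'a
  proof -
    let ?Y = "X \<inter> cball x (T * \<rho>)"
    have less: "\<rho> / 3 < T * \<rho>"
      using mult_right_mono[OF T, of \<rho>] \<rho> by linarith
    have "ereal_of_enat (cover_num x (T * \<rho>) (\<rho> / 3)) \<le> ereal (C * ((T * \<rho>) / (\<rho> / 3)) powr \<alpha>)"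
      using \<rho> less by (intro C) auto
    also have "(T * \<rho>) / (\<rho> / 3) = 3 * T"
      using \<rho> by simp
    also have "ereal (C * (3 * T) powr \<alpha>) \<le> ereal_of_enat (enat N)"
      by (simp add: N_def real_nat_ceiling_ge)
    finally have "cover_num x (T * \<rho>) (\<rho> / 3) \<le> enat N"
      by (simp only: ereal_of_enat_le_iff)
    from cover_num_attained[OF this] obtain F where F: "finite F" "card F \<le> N"
      "cball x (T * \<rho>) \<subseteq> (\<Union>y\<in>F. cball y (\<rho> / 3))"
      by blast
    have "\<forall>p\<in>?Y. \<exists>y\<in>F. dist y p \<le> \<rho> / 3"
    proof
      fix p assume "p \<in> ?Y"
      then have "p \<in> (\<Union>y\<in>F. cball y (\<rho> / 3))"
        using F(3) by blast
      then show "\<exists>y\<in>F. dist y p \<le> \<rho> / 3"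
        unfolding UN_iff mem_cball .
    qed
    then have "\<forall>p\<in>?Y. \<exists>y. y \<in> F \<and> dist y p \<le> \<rho> / 3"
      by blast
    from bchoice[OF this] obtain f
      where f: "\<And>p. p \<in> ?Y \<Longrightarrow> f p \<in> F" "\<And>p. p \<in> ?Y \<Longrightarrow> dist (f p) p \<le> \<rho> / 3"
      by blast
    have "inj_on f ?Y"
    proof (rule inj_onI, rule ccontr)
      fix p q assume pq: "p \<in> ?Y" "q \<in> ?Y" "f p = f q" "p \<noteq> q"
      have "\<rho> \<le> dist p q"
        using X pq by (auto simp: separated_def)
      also have "\<dots> \<le> dist (f p) p + dist (f p) q"
        by (rule dist_triangle3)
      also have "\<dots> \<le> \<rho> / 3 + \<rho> / 3"
        using f(2)[OF pq(1)] f(2)[OF pq(2)] pq(3) by simp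
      finally show False
        using \<rho> by simp
    qed
    moreover have "f ` ?Y \<subseteq> F"
      using f(1) by blast
    ultimately have "finite ?Y" "card ?Y \<le> card F"
      using F(1) by (auto intro: inj_on_finite card_inj_on_le)
    then show ?thesis
      using F(2) by simp
  qed
  then show ?thesis
    by blast
qed

section \<open>Distributing the mass of a node over its children\<close>

text \<open>One distribution on indices serves all nodes of the tree, whatever their number of children: index
  \<open>0\<close> selects a favourite child, the others are distributed by residue classes.\<close>

lemma selection_pmf_exists:
  assumes "0 < \<theta>" "\<theta> < 1" "0 < L"
  shows "\<exists>Q. pmf Q 0 = \<theta> \<and> (\<forall>i. pmf Q (Suc i) = (if i < L then (1 - \<theta>) / real L else 0))"
proof -
  define Q where "Q = bind_pmf (bernoulli_pmf \<theta>)
    (\<lambda>b. if b then return_pmf 0 else map_pmf Suc (pmf_of_set {..<L}))"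
  have set: "set_pmf (pmf_of_set {..<L}) = {..<L}"
    using assms by (intro set_pmf_of_set) auto
  have "pmf (map_pmf Suc (pmf_of_set {..<L})) 0 = 0"
    by (intro pmf_map_outside) auto
  moreover have "pmf (map_pmf Suc (pmf_of_set {..<L})) (Suc i) = (if i < L then 1 / real L else 0)" for i
    by (subst pmf_map_inj', simp, subst pmf_of_set) (use assms in auto)
  ultimately show ?thesis
    using assms by (intro exI[of _ Q]) (auto simp: Q_def pmf_bind)
qed

lemma card_mod_eq_le: "0 < m \<Longrightarrow> card {i. i < L \<and> i mod m = j} \<le> L div m + (1::nat)"
proof -
  assume m: "0 < m"
  have "inj_on (\<lambda>i. i div m) {i. i < L \<and> i mod m = j}"
    by (rule inj_onI) (metis (mono_tags, lifting) div_mult_mod_eq mem_Collect_eq)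
  moreover have "(\<lambda>i. i div m) ` {i. i < L \<and> i mod m = j} \<subseteq> {..L div m}"
    by (auto intro: div_le_mono)
  ultimately have "card {i. i < L \<and> i mod m = j} \<le> card {..L div m}"
    by (intro card_inj_on_le) auto
  then show ?thesis by simp
qed

text \<open>The \<open>m = card S - 1\<close> other children share the indices from 1 to
  \<open>L\<close> by residue classes. As \<open>m\<close> is at most \<open>L\<close>, every class
  is nonempty and has at most \<open>L / m + 1\<close>, hence at most \<open>2 * L / m\<close>,
  members of weight \<open>(1 - \<theta>) / L\<close>. Each such child thus gets at most
  \<open>2 / m\<close>, and the lower bound on \<open>card S\<close> makes this at most
  \<theta>.\<close>

lemma selection_exists:
  assumes Q0: "pmf Q 0 = \<theta>" and Q: "\<And>i. pmf Q (Suc i) = (if i < L then (1 - \<theta>) / real L else 0)"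
    and theta: "0 < \<theta>" "\<theta> < 1"
    and S: "finite S" "card S \<le> L" "2 / \<theta> + 1 \<le> real (card S)" "f \<in> S"
  shows "\<exists>\<sigma>. \<sigma> 0 = f \<and> (\<forall>i. \<sigma> i \<in> S) \<and> (\<forall>c\<in>S. \<exists>i\<in>set_pmf Q. \<sigma> i = c)
    \<and> (\<forall>c. measure_pmf.prob Q {i. \<sigma> i = c} \<le> \<theta>)"
proof -
  define m where "m = card (S - {f})"
  have "card S = Suc m"
    using S card_Suc_Diff1[of S f] by (simp add: m_def)
  then have m: "2 / \<theta> \<le> real m" "m \<le> L"
    using S by auto
  have "0 < 2 / \<theta>" using theta by simp
  then have m_pos: "0 < m"
    using m(1) by (cases "m = 0") auto
  obtain h where h: "bij_betw h {0..<m} (S - {f})"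
    using ex_bij_betw_nat_finite[of "S - {f}"] S by (auto simp: m_def)
  define \<sigma> where "\<sigma> i = (case i of 0 \<Rightarrow> f | Suc j \<Rightarrow> h (j mod m))" for i
  have hS: "h (j mod m) \<in> S - {f}" for j
    using bij_betwE[OF h] m_pos by auto
  have surj: "\<exists>i\<in>set_pmf Q. \<sigma> i = c" if "c \<in> S" for c
  proof (cases "c = f")
    case True
    then show ?thesis
      using Q0 theta by (intro bexI[of _ 0]) (auto simp: \<sigma>_def set_pmf_iff)
  next
    case False
    then have "c \<in> h ` {0..<m}"
      using that h by (simp add: bij_betw_def)
    then obtain j where j: "j < m" "h j = c"
      by auto
    then show ?thesis
      using Q[of j] m theta by (intro bexI[of _ "Suc j"]) (auto simp: \<sigma>_def set_pmf_iff)
  qed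
  have prob: "measure_pmf.prob Q {i. \<sigma> i = c} \<le> \<theta>" for c
  proof (cases "c = f")
    case True
    have "\<sigma> i = f \<longleftrightarrow> i = 0" for i
      using hS by (cases i) (auto simp: \<sigma>_def)
    then show ?thesis
      using Q0 True by (simp add: measure_pmf_single)
  next
    case False
    show ?thesis
    proof (cases "c \<in> S")
      case False
      then have "{i. \<sigma> i = c} = {}"
        using S(4) hS by (auto simp: \<sigma>_def split: nat.splits)
      then show ?thesis
        using theta by simp
    next
      case True
      then have "c \<in> h ` {0..<m}"
        using \<open>c \<noteq> f\<close> h by (simp add: bij_betw_def)
      then obtain j0 where j0: "j0 < m" "h j0 = c"
        by auto
      have inj: "h (j mod m) = c \<longleftrightarrow> j mod m = j0" for j
        using h j0 m_pos by (auto simp: bij_betw_def dest: inj_onD)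
      let ?J = "{i. i < L \<and> i mod m = j0}"
      \<comment> \<open>Infinitely many indices select \<open>c\<close>, but only finitely many of
        them carry mass.\<close>
      have sub: "{i. \<sigma> i = c} \<inter> set_pmf Q \<subseteq> Suc ` ?J"
      proof
        fix i assume "i \<in> {i. \<sigma> i = c} \<inter> set_pmf Q"
        then show "i \<in> Suc ` ?J"
          using \<open>c \<noteq> f\<close> Q inj by (cases i) (auto simp: \<sigma>_def set_pmf_iff split: if_splits)
      qed
      have "measure_pmf.prob Q {i. \<sigma> i = c} = measure_pmf.prob Q ({i. \<sigma> i = c} \<inter> set_pmf Q)"
        by (simp add: measure_Int_set_pmf)
      also have "\<dots> \<le> measure_pmf.prob Q (Suc ` ?J)"
        using sub by (intro measure_pmf.finite_measure_mono) auto
      also have "\<dots> = (\<Sum>i\<in>?J. pmf Q (Suc i))"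
        by (simp add: measure_measure_pmf_finite sum.reindex)
      also have "\<dots> = real (card ?J) * ((1 - \<theta>) / real L)"
        using Q by simp
      also have "\<dots> \<le> (2 * real L / real m) * ((1 - \<theta>) / real L)"
      proof (intro mult_right_mono)
        have "real (card ?J) \<le> real (L div m) + 1"
          using card_mod_eq_le[OF m_pos, of L j0] by linarith
        also have "\<dots> \<le> real L / real m + real L / real m"
          using m(2) m_pos by (intro add_mono of_nat_div_le_of_nat) (simp add: field_simps)
        finally show "real (card ?J) \<le> 2 * real L / real m" by simp
      qed (use theta in auto)
      also have "\<dots> = 2 * (1 - \<theta>) / real m"
        using m m_pos by simp
      also have "\<dots> \<le> 2 / real m"
        using theta by (intro divide_right_mono) auto
      also have "\<dots> \<le> \<theta>"
        using m(1) m_pos theta by (simp add: field_simps)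
      finally show ?thesis .
    qed
  qed
  show ?thesis
    using surj prob hS S(4) by (intro exI[of _ \<sigma>]) (auto simp: \<sigma>_def split: nat.splits)
qed

section \<open>Many children from the lower dimension\<close>

lemma lower_dim_cover_num:
  assumes "ereal s < lower_dim TYPE('a::metric_space)"
  obtains \<alpha> C where "s < \<alpha>" "0 < C"
    "\<And>(x::'a) r R. 0 < r \<Longrightarrow> r < R \<Longrightarrow> ereal R < ediam TYPE('a) \<Longrightarrow>
      ereal (C * (R / r) powr \<alpha>) \<le> ereal_of_enat (cover_num x R r)"
proof -
  obtain e where e: "e \<in> {ereal \<alpha> | \<alpha>. \<exists>C>0. \<forall>(x::'a) r R. 0 < r \<and> r < R \<and> ereal R < ediam TYPE('a) \<longrightarrow>
        ereal_of_enat (cover_num x R r) \<ge> ereal (C * (R / r) powr \<alpha>)}" and less: "ereal s < e"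
    using assms unfolding lower_dim_def less_Sup_iff by (elim bexE) (rule that)
  from e obtain \<alpha> C where \<alpha>: "e = ereal \<alpha>" and C: "0 < C"
      "\<forall>(x::'a) r R. 0 < r \<and> r < R \<and> ereal R < ediam TYPE('a) \<longrightarrow>
        ereal_of_enat (cover_num x R r) \<ge> ereal (C * (R / r) powr \<alpha>)"
    unfolding mem_Collect_eq by (elim exE conjE) (rule that)
  show thesis
  proof (rule that[of \<alpha> C])
    show "s < \<alpha>"
      using less \<alpha> by simp
    show "ereal (C * (R / r) powr \<alpha>) \<le> ereal_of_enat (cover_num x R r)"
      if "0 < r" "r < R" "ereal R < ediam TYPE('a)" for x :: 'a and r R
      using C(2) that by simp
  qed (rule C(1))
qed

lemma dist_le_ediam: "ereal (dist x y) \<le> ediam TYPE('a)" for x y :: "'a::metric_space"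
  unfolding ediam_def by (rule SUP_upper2[OF UNIV_I]) (rule SUP_upper[OF UNIV_I])

text \<open>After division by \<open>(1 / l) powr \<alpha>\<close> the inequality reads
  \<open>l powr (\<alpha> - s) \<le> \<delta>\<close>, which holds for small \<open>l\<close>
  because \<open>s < \<alpha>\<close>.\<close>

lemma contraction_ratio_exists:
  fixes s \<alpha> C :: real
  assumes "s < \<alpha>" "0 < C"
  shows "\<exists>l. 0 < l \<and> l \<le> 1/8 \<and> 3 * (1 / l) powr s \<le> C * (1 / (4 * l)) powr \<alpha>"
proof -
  define \<delta> where "\<delta> = C * (1 / 4) powr \<alpha> / 3"
  define l where "l = min (1/8) (\<delta> powr (1 / (\<alpha> - s)))"
  have \<delta>: "0 < \<delta>"
    using assms by (simp add: \<delta>_def)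
  then have l: "0 < l" "l \<le> 1/8" "l \<le> \<delta> powr (1 / (\<alpha> - s))"
    by (auto simp: l_def)
  have "l powr (\<alpha> - s) \<le> (\<delta> powr (1 / (\<alpha> - s))) powr (\<alpha> - s)"
    using l assms by (intro powr_mono2) auto
  also have "\<dots> = \<delta>"
    using \<delta> assms by (simp add: powr_powr)
  finally have "3 * (l powr (\<alpha> - s) * (1 / l) powr \<alpha>) \<le> 3 * (\<delta> * (1 / l) powr \<alpha>)"
    by (intro mult_left_mono mult_right_mono) auto
  also have "\<dots> = C * ((1 / 4) powr \<alpha> * (1 / l) powr \<alpha>)"
    by (simp add: \<delta>_def)
  also have "(1 / 4) powr \<alpha> * (1 / l) powr \<alpha> = (1 / 4 * (1 / l)) powr \<alpha>"
    by (rule powr_mult[symmetric])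
  also have "1 / 4 * (1 / l) = 1 / (4 * l)"
    by simp
  also have "l powr (\<alpha> - s) * (1 / l) powr \<alpha> = (1 / l) powr s"
    using l(1) by (simp add: powr_diff powr_divide)
  finally show ?thesis
    using l by blast
qed

text \<open>A point within \<open>\<rho> / 4\<close> of \<open>y\<close> is within
  \<open>\<rho> / 8\<close> of some \<open>c\<close> in \<open>X\<close>, and this \<open>c\<close>
  is closer than \<open>\<rho> / 2\<close> to \<open>y\<close>. So \<open>S\<close> gives a cover of
  that ball by balls of radius \<open>l * \<rho>\<close>, and the covering number bounds its size
  from below.\<close>

lemma card_children_ge:
  fixes y :: "'a::metric_space"
  assumes C: "\<And>(x::'a) r R. 0 < r \<Longrightarrow> r < R \<Longrightarrow> ereal R < ediam TYPE('a) \<Longrightarrow>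
      ereal (C * (R / r) powr \<alpha>) \<le> ereal_of_enat (cover_num x R r)"
    and l: "0 < l" "l \<le> 1/8" and \<rho>: "0 < \<rho>" "ereal (\<rho> / 4) < ediam TYPE('a)"
    and X: "\<forall>x. \<exists>y\<in>X. dist y x < l * \<rho>"
    and S: "finite S" "\<And>c. c \<in> X \<Longrightarrow> 2 * dist c y < \<rho> \<Longrightarrow> c \<in> S"
  shows "C * (1 / (4 * l)) powr \<alpha> \<le> real (card S)"
proof -
  have l\<rho>: "l * \<rho> \<le> \<rho> / 8"
    using mult_right_mono[OF l(2), of \<rho>] \<rho> by simp
  have "cball y (\<rho> / 4) \<subseteq> (\<Union>c\<in>S. cball c (l * \<rho>))"
  proof
    fix z assume "z \<in> cball y (\<rho> / 4)"
    then have z: "dist y z \<le> \<rho> / 4" by simp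
    obtain c where c: "c \<in> X" "dist c z < l * \<rho>"
      using X by blast
    have "2 * dist c y < \<rho>"
      using z c(2) l\<rho> \<rho>(1) dist_triangle2[of c y z] by linarith
    then have "c \<in> S"
      using S(2) c(1) by blast
    then show "z \<in> (\<Union>c\<in>S. cball c (l * \<rho>))"
      using c(2) by (auto intro!: bexI[of _ c])
  qed
  then have "cover_num y (\<rho> / 4) (l * \<rho>) \<le> enat (card S)"
    by (rule cover_num_le[OF S(1)])
  then have "ereal_of_enat (cover_num y (\<rho> / 4) (l * \<rho>)) \<le> ereal (real (card S))"
    by (metis ereal_of_enat_le_iff ereal_of_enat_simps(1))
  moreover have "ereal (C * ((\<rho> / 4) / (l * \<rho>)) powr \<alpha>) \<le> ereal_of_enat (cover_num y (\<rho> / 4) (l * \<rho>))"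
    using l \<rho> l\<rho> by (intro C) auto
  ultimately have "ereal (C * ((\<rho> / 4) / (l * \<rho>)) powr \<alpha>) \<le> ereal (real (card S))"
    by (rule order_trans[rotated])
  moreover have "(\<rho> / 4) / (l * \<rho>) = 1 / (4 * l)"
    using \<rho> by simp
  ultimately show ?thesis
    by simp
qed

section \<open>Existence of the measure\<close>

theorem theorem4p1:
  fixes s :: real
  assumes "\<exists>x y :: 'a::complete_space. x \<noteq> y"
    and "assouad_dim TYPE('a) < \<infinity>"
    and "0 < s" and "ereal s < lower_dim TYPE('a)"
  shows "\<exists>\<mu> :: 'a set \<Rightarrow> ennreal. borel_regular_outer_measure \<mu> \<and> spt \<mu> = UNIV \<and>
           lower_dim_measure \<mu> = ereal s"
proof -
  define D where "D = ediam TYPE('a)"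
  obtain x0 y0 :: 'a where xy: "x0 \<noteq> y0"
    using assms(1) by blast
  \<comment> \<open>A fixed radius below the diameter, at which admissible exponents are tested at
    the end.\<close>
  obtain R0 where R0: "0 < R0" "ereal R0 < D"
  proof (rule that)
    show "0 < dist x0 y0 / 2"
      using xy by simp
    have "ereal (dist x0 y0 / 2) < ereal (dist x0 y0)"
      using xy by simp
    also have "\<dots> \<le> D"
      unfolding D_def by (rule dist_le_ediam)
    finally show "ereal (dist x0 y0 / 2) < D" .
  qed
  obtain \<alpha> C where \<alpha>: "s < \<alpha>" and C: "0 < C"
    "\<And>(x::'a) r R. 0 < r \<Longrightarrow> r < R \<Longrightarrow> ereal R < ediam TYPE('a) \<Longrightarrow>
      ereal (C * (R / r) powr \<alpha>) \<le> ereal_of_enat (cover_num x R r)"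
    using lower_dim_cover_num[OF assms(4)] by blast
  \<comment> \<open>Each node must have at least \<open>2 / \<theta> + 1\<close> children; as \<open>s < \<alpha>\<close>, this holds for small \<open>l\<close>.\<close>
  obtain l where l: "0 < l" "l \<le> 1/8" and lC: "3 * (1 / l) powr s \<le> C * (1 / (4 * l)) powr \<alpha>"
    using contraction_ratio_exists[OF \<alpha> C(1)] by blast
  define \<theta> where "\<theta> = l powr s"
  have \<theta>: "0 < \<theta>" "\<theta> < 1"
    using l assms(3) powr_less_mono2[of s l 1] by (auto simp: \<theta>_def)
  have \<theta>C: "2 / \<theta> + 1 \<le> C * (1 / (4 * l)) powr \<alpha>"
  proof -
    have "2 / \<theta> + 1 \<le> 3 * (1 / \<theta>)"
      using \<theta> by (simp add: field_simps)
    also have "1 / \<theta> = (1 / l) powr s"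
      by (simp add: \<theta>_def powr_divide)
    finally show ?thesis
      using lC by simp
  qed
  \<comment> \<open>In the bounded case the level 0 separation is twice the diameter, which forces
    \<open>net 0\<close> to be a single point.\<close>
  define \<rho> where "\<rho> = (if D = \<infinity> then 1 else 2 * real_of_ereal D)"
  define top :: "nat \<Rightarrow> int" where "top n = (if D = \<infinity> then - int n else 0)" for n
  have D: "D \<noteq> \<infinity> \<Longrightarrow> ereal (\<rho> / 2) = D"
    using R0 by (cases D) (auto simp: \<rho>_def)
  have \<rho>: "0 < \<rho>"
  proof (cases "D = \<infinity>")
    case False
    then have "ereal R0 < ereal (\<rho> / 2)"
      using R0 D by simp
    then show ?thesis using R0 by simp
  qed (simp add: \<rho>_def)
  define a where "a k = \<rho> * l powi k" for k :: int
  have a_pos: "0 < a k" for k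
    using \<rho> l by (simp add: a_def)
  have a_Suc: "a (k + 1) = l * a k" for k
    using l by (simp add: a_def power_int_add)
  have a_anti: "a k \<le> a j" if "j \<le> k" for j k
    unfolding a_def using \<rho> l that by (intro mult_left_mono power_int_decreasing) auto
  have a_D: "ereal (a k / 4) < D" if "top n \<le> k" for n k
  proof (cases "D = \<infinity>")
    case False
    then have "a k \<le> a 0"
      using that by (intro a_anti) (simp add: top_def)
    also have "a 0 = \<rho>"
      by (simp add: a_def)
    finally have "ereal (a k / 4) < ereal (\<rho> / 2)"
      using \<rho> by simp
    then show ?thesis
      using D[OF False] by simp
  qed simp
  \<comment> \<open>In the bounded case a scale below \<open>R / 8\<close> is below
    \<open>a 0\<close>, so the level is nonnegative and \<open>top\<close> reaches it.\<close>
  have top_le: "\<exists>n. top n \<le> k" if k: "a k < R / 8" and R: "ereal R < D" for k R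
  proof (cases "D = \<infinity>")
    case True
    then show ?thesis
      by (intro exI[of _ "nat (- k)"]) (simp add: top_def)
  next
    case False
    then have "ereal R < ereal (\<rho> / 2)"
      using R D by simp
    then have "R < \<rho> / 2"
      by simp
    moreover have "a 0 = \<rho>"
      by (simp add: a_def)
    ultimately have "a k < a 0"
      using k \<rho> by linarith
    then have "0 \<le> k"
      using a_anti[of k 0] by (cases "0 \<le> k") auto
    then show ?thesis
      using False by (simp add: top_def)
  qed

  have "\<forall>k. \<exists>X. x0 \<in> X \<and> separated (a k) X \<and> (\<forall>x. \<exists>y\<in>X. dist y x < a k)"
    using maximal_separated_exists[OF a_pos] by blast
  from choice[OF this] obtain net where net: "\<And>k. x0 \<in> net k" "\<And>k. separated (a k) (net k)"
    "\<And>k. \<forall>x. \<exists>y\<in>net k. dist y x < a k"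
    by blast
  \<comment> \<open>The last clause serves twice: it makes \<open>x0\<close> the parent of nearby
    points, including itself, and it makes all points of \<open>net (k + 1)\<close> closer than
    \<open>a k / 2\<close> to a node its children.\<close>
  have "\<forall>k. \<exists>p. \<forall>c. p c \<in> net k \<and> dist (p c) c < a k \<and> (\<forall>z\<in>net k. 2 * dist c z < a k \<longrightarrow> p c = z)"
  proof
    fix k
    have "\<forall>c. \<exists>y. y \<in> net k \<and> dist y c < a k \<and> (\<forall>z\<in>net k. 2 * dist c z < a k \<longrightarrow> y = z)"
      using nearest_in_separated[OF net(2) net(3)] by blast
    from choice[OF this] show "\<exists>p. \<forall>c. p c \<in> net k \<and> dist (p c) c < a k \<and> (\<forall>z\<in>net k. 2 * dist c z < a k \<longrightarrow> p c = z)" .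
  qed
  from choice[OF this] obtain par where par: "\<And>k c. par k c \<in> net k" "\<And>k c. dist (par k c) c < a k"
    "\<And>k c z. z \<in> net k \<Longrightarrow> 2 * dist c z < a k \<Longrightarrow> par k c = z"
    by blast

  \<comment> \<open>The factor \<open>1 / l\<close> is the ratio of consecutive scales, so
    \<open>N\<close> bounds the number of children; as \<open>1 / l\<close> is at least 3, it also
    serves for \<open>net_card\<close>.\<close>
  obtain N where N: "\<And>\<rho> X (x::'a). 0 < \<rho> \<Longrightarrow> separated \<rho> X \<Longrightarrow>
      finite (X \<inter> cball x (1 / l * \<rho>)) \<and> card (X \<inter> cball x (1 / l * \<rho>)) \<le> N"
    using card_separated_le[OF assms(2), of "1 / l"] l by auto
  define children where "children k y = {c\<in>net (k + 1). par k c = y}" for k y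
  have children_sub: "children k y \<subseteq> net (k + 1) \<inter> cball y (1 / l * a (k + 1))" for k y
    using less_imp_le[OF par(2)[of k]] l by (auto simp: children_def a_Suc)
  note ball_bound = N[OF a_pos net(2)]
  have children_fin: "finite (children k y)" for k y
    by (rule finite_subset[OF children_sub conjunct1[OF ball_bound]])
  have children_le: "card (children k y) \<le> N" for k y
    by (rule order_trans[OF card_mono[OF conjunct1[OF ball_bound] children_sub] conjunct2[OF ball_bound]])
  have children_ge: "2 / \<theta> + 1 \<le> real (card (children k y))" if "top n \<le> k" "y \<in> net k" for n k y
  proof -
    have "C * (1 / (4 * l)) powr \<alpha> \<le> real (card (children k y))"
    proof (rule card_children_ge[OF C(2) l a_pos])
      show "ereal (a k / 4) < ediam TYPE('a)"
        using a_D[OF that(1)] by (simp add: D_def)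
      show "\<forall>x. \<exists>y\<in>net (k + 1). dist y x < l * a k"
        using net(3)[of "k + 1"] by (simp add: a_Suc)
      show "c \<in> children k y" if "c \<in> net (k + 1)" "2 * dist c y < a k" for c
        using that par(3)[OF \<open>y \<in> net k\<close>] by (simp add: children_def)
    qed (rule children_fin | assumption)+
    then show ?thesis
      using \<theta>C by simp
  qed

  have "0 < N"
  proof -
    have "0 < 2 / \<theta> + 1"
      using \<theta> by (simp add: add_pos_pos)
    then have "0 < card (children (top 0) x0)"
      using children_ge[of 0 "top 0" x0] net(1) by (cases "card (children (top 0) x0)") auto
    then show ?thesis
      using children_le[of "top 0" x0] by linarith
  qed
  then obtain Q where Q: "pmf Q 0 = \<theta>" "\<And>i. pmf Q (Suc i) = (if i < N then (1 - \<theta>) / real N else 0)"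
    using selection_pmf_exists[OF \<theta>] by blast

  define admissible where "admissible k y \<longleftrightarrow> (\<exists>n. top n \<le> k) \<and> y \<in> net k" for k y
  define selects where "selects k y \<sigma> \<longleftrightarrow> (y = x0 \<longrightarrow> \<sigma> 0 = x0) \<and> (\<forall>i. \<sigma> i \<in> children k y) \<and>
    (\<forall>c\<in>children k y. \<exists>i\<in>set_pmf Q. \<sigma> i = c) \<and> (\<forall>c. measure_pmf.prob Q {i. \<sigma> i = c} \<le> \<theta>)" for k y \<sigma>
  \<comment> \<open>Outside the tree the selection is made constant, so that \<open>sel_dist\<close>
    holds for all levels and points.\<close>
  have "\<exists>\<sigma>. if admissible k y then selects k y \<sigma> else \<sigma> = (\<lambda>_. y)" for k y
  proof (cases "admissible k y")
    case True
    then obtain n where n: "top n \<le> k" "y \<in> net k"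
      by (auto simp: admissible_def)
    \<comment> \<open>The favourite child of \<open>x0\<close> is \<open>x0\<close> itself, which
      receives the mass \<theta> of index 0.\<close>
    have "\<exists>f\<in>children k y. y = x0 \<longrightarrow> f = x0"
    proof (cases "y = x0")
      case True
      have "par k x0 = x0"
        using par(3)[OF net(1)] a_pos by simp
      then have "x0 \<in> children k y"
        using True net(1) by (simp add: children_def)
      then show ?thesis by blast
    next
      case False
      have "0 < 2 / \<theta> + 1"
        using \<theta> by (simp add: add_pos_pos)
      then have "children k y \<noteq> {}"
        using children_ge[OF n] by auto
      then show ?thesis using False by blast
    qed
    then obtain f where f: "f \<in> children k y" "y = x0 \<longrightarrow> f = x0" by blast
    obtain \<sigma> where "\<sigma> 0 = f" "\<forall>i. \<sigma> i \<in> children k y" "\<forall>c\<in>children k y. \<exists>i\<in>set_pmf Q. \<sigma> i = c"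
      "\<forall>c. measure_pmf.prob Q {i. \<sigma> i = c} \<le> \<theta>"
      using selection_exists[OF Q \<theta> children_fin children_le children_ge[OF n] f(1)] by (elim exE conjE) (rule that)
    then show ?thesis
      using True f by (intro exI[of _ \<sigma>]) (simp add: selects_def)
  qed simp
  then have "\<exists>sel. \<forall>k y. if admissible k y then selects k y (sel k y) else sel k y = (\<lambda>_. y)"
    by (intro choice allI)
  then obtain sel where sel: "\<And>k y. admissible k y \<Longrightarrow> selects k y (sel k y)"
    and sel_triv: "\<And>k y. \<not> admissible k y \<Longrightarrow> sel k y = (\<lambda>_. y)"
    by metis
  have sel: "y = x0 \<longrightarrow> sel k y 0 = x0" "sel k y i \<in> children k y"
      "c \<in> children k y \<Longrightarrow> \<exists>i\<in>set_pmf Q. sel k y i = c" "measure_pmf.prob Q {i. sel k y i = c} \<le> \<theta>"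
    if "top n \<le> k" "y \<in> net k" for n k y i c
  proof -
    have "admissible k y"
      using that by (auto simp: admissible_def)
    from sel[OF this] show "y = x0 \<longrightarrow> sel k y 0 = x0" "sel k y i \<in> children k y"
      "c \<in> children k y \<Longrightarrow> \<exists>i\<in>set_pmf Q. sel k y i = c" "measure_pmf.prob Q {i. sel k y i = c} \<le> \<theta>"
      by (simp_all add: selects_def)
  qed

  interpret net_tree Q sel a l net par x0 top \<theta> N
  proof
    show "dist (sel k y i) y \<le> a k" for k y i
    proof (cases "admissible k y")
      case True
      then obtain n where "top n \<le> k" "y \<in> net k"
        by (auto simp: admissible_def)
      then have "par k (sel k y i) = y"
        using sel(2) by (simp add: children_def)
      then show ?thesis
        using par(2)[of k "sel k y i"] by (simp add: dist_commute)
    next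
      case False
      then show ?thesis
        using a_pos[of k] by (simp add: sel_triv)
    qed
    show "\<exists>c\<in>net k. dist c x \<le> a k" for k x
      using net(3)[of k] by (meson less_imp_le)
    show "finite (net k \<inter> cball x (3 * a k)) \<and> card (net k \<inter> cball x (3 * a k)) \<le> N" for k x
    proof -
      have "3 \<le> 1 / l"
        using l by (simp add: field_simps)
      then have "net k \<inter> cball x (3 * a k) \<subseteq> net k \<inter> cball x (1 / l * a k)"
        using mult_right_mono[of 3 "1 / l" "a k"] a_pos[of k] by auto
      then show ?thesis
        using N[OF a_pos net(2), of k x] by (meson card_mono finite_subset order_trans)
    qed
    show "dist (par k c) c \<le> a k" for k c
      using par(2)[of k c] by simp
    show "par k c = x0" if "2 * dist c x0 < a k" for k c
      using par(3)[OF net(1) that] .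
    show "sel k y i \<in> net (k + 1)" "par k (sel k y i) = y" if "top n \<le> k" "y \<in> net k" for n k y i
      using sel(2)[OF that] by (simp_all add: children_def)
    show "measure_pmf.prob Q {i. sel k y i = c} \<le> \<theta>" if "top n \<le> k" "y \<in> net k" for n k y c
      by (rule sel(4)[OF that])
    show "\<exists>i\<in>set_pmf Q. sel k (par k c) i = c" if "top n \<le> k" "c \<in> net (k + 1)" for n k c
      using that(2) by (intro sel(3)[OF that(1) par(1)]) (simp add: children_def)
    show "sel k x0 0 = x0" if "top n \<le> k" for n k
      using sel(1)[OF that net(1)] by simp
    show "decseq top"
      by (auto simp: decseq_def top_def)
    show "\<exists>n. top n < k \<and> (net (top n) = {x0} \<or> 4 * dist c x0 < a (top n))" if "0 < k" for k c
    proof (cases "D = \<infinity>")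
      case True
      have pos: "0 < 4 * dist c x0 + 1"
        using zero_le_dist[of c x0] by linarith
      have "l < 1"
        using l by simp
      \<comment> \<open>Going up far enough, the scale exceeds \<open>4 * dist c x0\<close>; the
        added 1 keeps the denominator positive.\<close>
      from real_arch_pow_inv[OF divide_pos_pos[OF a_pos pos] this]
      obtain m where m: "l ^ m < a 0 / (4 * dist c x0 + 1)" ..
      have "a (top m) = \<rho> / l ^ m"
        using True by (simp add: a_def top_def power_int_minus divide_inverse)
      moreover have "l ^ m < \<rho> / (4 * dist c x0 + 1)"
        using m by (simp add: a_def)
      then have "4 * dist c x0 + 1 < \<rho> / l ^ m"
        using l pos by (simp only: pos_less_divide_eq mult.commute zero_less_power)
      ultimately show ?thesis
        using that True by (intro exI[of _ m]) (simp add: top_def)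
    next
      case False
      have "z = x0" if "z \<in> net 0" for z
      proof (rule ccontr)
        assume "z \<noteq> x0"
        then have "a 0 \<le> dist z x0"
          using net(1,2)[of 0] that by (auto simp: separated_def)
        also have "ereal (dist z x0) \<le> ereal (\<rho> / 2)"
          using dist_le_ediam[of z x0] D[OF False] by (simp add: D_def)
        then have "dist z x0 \<le> \<rho> / 2" by simp
        finally show False
          using \<rho> by (simp add: a_def)
      qed
      then have "net 0 = {x0}"
        using net(1) by blast
      then show ?thesis
        using that False by (simp add: top_def)
    qed
  qed (use l a_pos a_Suc \<theta> net(1) par(1) Q(1) in auto)

  define \<nu> where "\<nu> = outer_measure_of \<mu>"
  have \<nu>: "\<nu> (cball x r) = emeasure \<mu> (cball x r)" for x r
    unfolding \<nu>_def by (rule outer_measure_of_eq) simp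
  have "borel_regular_outer_measure \<nu>"
    unfolding \<nu>_def by (rule borel_regular_outer_measure_of) simp
  moreover have "spt \<nu> = UNIV"
  proof -
    have "0 < \<nu> U" if U: "open U" "x \<in> U" for x U
    proof -
      obtain r where r: "0 < r" "cball x r \<subseteq> U"
        using U open_contains_cball by blast
      have "0 < \<nu> (cball x r)"
        unfolding \<nu> using r(1) by (rule \<mu>_cball_pos)
      also have "\<dots> \<le> \<nu> U"
        unfolding \<nu>_def by (rule outer_measure_of_mono[OF r(2)])
      finally show ?thesis .
    qed
    then show ?thesis
      by (auto simp: spt_def)
  qed
  moreover have "lower_dim_measure \<nu> = ereal s"
    unfolding lower_dim_measure_def
  \<comment> \<open>The supremum is a maximum: balls around \<open>x0\<close> exclude exponents
    above \<open>s\<close>, and \<open>s\<close> itself is admissible by the ratio estimate.\<close>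
  proof (rule antisym[OF Sup_least Sup_upper])
    fix e
    assume "e \<in> {ereal \<alpha> |\<alpha>. \<exists>C>0. \<forall>(x::'a) r R. 0 < r \<and> r < R \<and> ereal R < ediam TYPE('a) \<longrightarrow>
      ennreal (C * (R / r) powr \<alpha>) \<le> \<nu> (cball x R) / \<nu> (cball x r)}"
    then obtain \<beta> B where e: "e = ereal \<beta>" and B: "0 < B"
      "\<forall>(x::'a) r R. 0 < r \<and> r < R \<and> ereal R < ediam TYPE('a) \<longrightarrow>
      ennreal (B * (R / r) powr \<beta>) \<le> \<nu> (cball x R) / \<nu> (cball x r)"
      unfolding mem_Collect_eq by (elim exE conjE) (rule that)
    have "\<beta> \<le> s"
    proof (rule root_exponent_le[OF assms(3) \<theta>_def R0(1) B(1)])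
      show "top 0 \<le> 0"
        by (simp add: top_def)
      show "ennreal (B * (R0 / r) powr \<beta>) \<le> emeasure \<mu> (cball x0 R0) / emeasure \<mu> (cball x0 r)"
        if "0 < r" "r < R0" for r
        using B(2) that R0(2) unfolding \<nu> D_def by blast
    qed
    then show "e \<le> ereal s"
      using e by simp
  next
    define B where "B = 1 / ((real N + 1) * (8 / l\<^sup>2) powr s)"
    have "0 < B"
      using l by (simp add: B_def)
    moreover have "ennreal (B * (R / r) powr s) \<le> \<nu> (cball x R) / \<nu> (cball x r)"
      if "0 < r" "r < R" "ereal R < ediam TYPE('a)" for x :: 'a and r R
      unfolding \<nu> B_def using top_le[of _ R] that by (intro \<mu>_ball_ratio[OF assms(3) \<theta>_def]) (auto simp: D_def)
    ultimately show "ereal s \<in> {ereal \<alpha> |\<alpha>. \<exists>C>0. \<forall>(x::'a) r R. 0 < r \<and> r < R \<and> ereal R < ediam TYPE('a) \<longrightarrow>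
      ennreal (C * (R / r) powr \<alpha>) \<le> \<nu> (cball x R) / \<nu> (cball x r)}"
      by blast
  qed
  ultimately show ?thesis
    by blast
qed

end
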